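(* Let $K$ be a field, $\lambda\in K$. Let $(A,\mu,\Delta,\alpha_A,\beta_A,\psi_A,\omega_A)$ be a $\lambda$-infBH-bialgebra and let $(M,\triangleright,\triangleleft,\rho,\varphi,\alpha_M,\beta_M,\psi_M,\omega_M)$ be a $\lambda$-infBH-Hopf bimodule over it. Write $\Delta(a)=a_1\otimes a_2$, $\rho(m)=m_{-1}\otimes m_0$, $\varphi(m)=m_{(0)}\otimes m_{(1)}$. For $a,b\in A$, $m\in M$ set $$a\star m=\big(\beta_A^2\psi_A(m_{-1})\,\alpha_A(a)\big)\triangleright\alpha_M^2\beta_M\omega_M(m_0)+\big(\beta_M^2\psi_M(m_{(0)})\triangleleft\alpha_A(a)\big)\triangleleft\alpha_A^2\beta_A\omega_A(m_{(1)}),$$ $$m\star a=\big(\beta_A^2\psi_A(a_1)\triangleright\alpha_M(m)\big)\triangleleft\alpha_A^2\beta_A\omega_A(a_2),\qquad a\star b=\big(\beta_A^2\psi_A(b_1)\,\alpha_A(a)\big)\,\alpha_A^2\beta_A\omega_A(b_2).$$ Then $(M,\star,\alpha_M^2\beta_M,\alpha_M^2\beta_M^2\psi_M\omega_M)$ is a BiHom-pre-Lie bimodule over the BiHom-pre-Lie algebra $(A,\star,\alpha_A^2\beta_A,\alpha_A^2\beta_A^2\psi_A\omega_A)$.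
   Context: Everything is over the field $K$; (co)units are not assumed. BiHom-associative algebra $(A,\mu,\alpha,\beta)$: $\mu$ (written $ab$) and $\alpha,\beta$ linear, $\alpha\beta=\beta\alpha$, $\alpha,\beta$ multiplicative, $\alpha(a)(bc)=(ab)\beta(c)$. BiHom-coassociative coalgebra $(C,\Delta,\psi,\omega)$: $\psi\omega=\omega\psi$, $(\psi\otimes\psi)\Delta=\Delta\psi$, $(\omega\otimes\omega)\Delta=\Delta\omega$, $(\Delta\otimes\psi)\Delta=(\omega\otimes\Delta)\Delta$. $\lambda$-infBH-bialgebra ($\lambda$-infinitesimal BiHom-bialgebra) $(A,\mu,\Delta,\alpha,\beta,\psi,\omega)$: $(A,\mu,\alpha,\beta)$ BiHom-associative, $(A,\Delta,\psi,\omega)$ BiHom-coassociative, each of $\alpha,\beta$ commutes with each of $\psi,\omega$, $(\alpha\otimes\alpha)\Delta=\Delta\alpha$, $(\beta\otimes\beta)\Delta=\Delta\beta$, $\psi,\omega$ multiplicative, and $\Delta(ab)=\omega(a)b_1\otimes\beta(b_2)+\alpha(a_1)\otimes a_2\psi(b)+\lambda\,\alpha\omega(a)\otimes\beta\psi(b)$. Bimodule $(M,\triangleright,\triangleleft,\alpha_M,\beta_M)$ over $(A,\mu,\alpha_A,\beta_A)$: $\alpha_M\beta_M=\beta_M\alpha_M$; $f_M(a\triangleright m)=f_A(a)\triangleright f_M(m)$, $f_M(m\triangleleft a)=f_M(m)\triangleleft f_A(a)$ for $f\in\{\alpha,\beta\}$; $\alpha_A(a)\triangleright(a'\triangleright m)=(aa')\triangleright\beta_M(m)$;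 $\alpha_M(m)\triangleleft(aa')=(m\triangleleft a)\triangleleft\beta_A(a')$; $\alpha_A(a)\triangleright(m\triangleleft a')=(a\triangleright m)\triangleleft\beta_A(a')$. Bicomodule $(M,\rho,\varphi,\psi_M,\omega_M)$ over $(A,\Delta,\psi_A,\omega_A)$, $\rho:M\to A\otimes M$, $\varphi:M\to M\otimes A$: $\psi_M\omega_M=\omega_M\psi_M$; $(g_A\otimes g_M)\rho=\rho g_M$, $(g_M\otimes g_A)\varphi=\varphi g_M$ for $g\in\{\psi,\omega\}$; $(\omega_A\otimes\rho)\rho=(\Delta\otimes\psi_M)\rho$; $(\omega_M\otimes\Delta)\varphi=(\varphi\otimes\psi_A)\varphi$; $(\omega_A\otimes\varphi)\rho=(\rho\otimes\psi_A)\varphi$. $\lambda$-infBH-Hopf bimodule $(M,\triangleright,\triangleleft,\rho,\varphi,\alpha_M,\beta_M,\psi_M,\omega_M)$: any two of the linear maps $\alpha_M,\beta_M,\psi_M,\omega_M$ commute; it is a bimodule and a bicomodule; and $\rho(a\triangleright m)=\omega_A(a)m_{-1}\otimes\beta_M(m_0)+\alpha_A(a_1)\otimes a_2\triangleright\psi_M(m)+\lambda\,\alpha_A\omega_A(a)\otimes\beta_M\psi_M(m)$, $\varphi(m\triangleleft a)=\omega_M(m)\triangleleft a_1\otimes\beta_A(a_2)+\alpha_M(m_{(0)})\otimes m_{(1)}\psi_A(a)+\lambda\,\alpha_M\omega_M(m)\otimes\beta_A\psi_A(a)$, $\varphi(a\triangleright m)=\omega_A(a)\triangleright m_{(0)}\otimes\beta_A(m_{(1)})$,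 $\rho(m\triangleleft a)=\alpha_A(m_{-1})\otimes m_0\triangleleft\psi_A(a)$. (Left) BiHom-pre-Lie algebra $(A,\circ,\alpha,\beta)$: bilinear $\circ$, commuting linear multiplicative $\alpha,\beta$, with $\alpha\beta(a)\circ(\alpha(b)\circ c)-(\beta(a)\circ\alpha(b))\circ\beta(c)=\alpha\beta(b)\circ(\alpha(a)\circ c)-(\beta(b)\circ\alpha(a))\circ\beta(c)$. BiHom-pre-Lie bimodule $(M,\circ,\alpha',\beta')$ over $(A,\circ,\alpha,\beta)$: bilinear operations $a\circ m$, $m\circ a\in M$, commuting linear $\alpha',\beta':M\to M$ with $\alpha'(a\circ m)=\alpha(a)\circ\alpha'(m)$, $\alpha'(m\circ a)=\alpha'(m)\circ\alpha(a)$, the same for $\beta',\beta$, and $\alpha\beta(a)\circ(\alpha(b)\circ m)-(\beta(a)\circ\alpha(b))\circ\beta'(m)=\alpha\beta(b)\circ(\alpha(a)\circ m)-(\beta(b)\circ\alpha(a))\circ\beta'(m)$, $\alpha\beta(a)\circ(\alpha'(m)\circ c)-(\beta(a)\circ\alpha'(m))\circ\beta(c)=\alpha'\beta'(m)\circ(\alpha(a)\circ c)-(\beta'(m)\circ\alpha(a))\circ\beta(c)$.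
   Formalization: The formal statement also assumes that α_M, β_M are compatible with the coactions ρ, φ and that ψ_M, ω_M are compatible with the actions ▷, ◁; without these the claim fails (e.g. A=K, Δ=0, λ=0, M=K², ρ(x,y)=1⊗(y,0), α_M(x,y)=(x,0)). *)

theory Defs
  imports Complex_Main "HOL-Library.Poly_Mapping" "HOL-Library.Product_Plus"
begin

section \<open>Tensor products of vector spaces\<close>

text \<open>
  A vector space over the field \<^typ>\<open>'k\<close> is a type with a scalar multiplication satisfying
  \<^const>\<open>vector_space\<close>. The tensor product of \<open>V\<close> and \<open>W\<close> is the free vector space on \<open>V \<times> W\<close>
  modulo the span of the bilinearity relations. A type cannot depend on the scalar
  multiplications, so the quotient is realised inside the free vector space, on a linear
  complement of the relations: \<open>tensor_nf\<close> is a linear projection whose kernel is the span of the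
  relations, and \<open>tensor_space\<close> is its range. The lemmas at the end of this section show that this
  is the tensor product: it is spanned by the pure tensors, and every bilinear map factors
  uniquely through it.
\<close>

definition free_scale :: "'k::field \<Rightarrow> ('x \<Rightarrow>\<^sub>0 'k) \<Rightarrow> ('x \<Rightarrow>\<^sub>0 'k)" where
  "free_scale c p = Poly_Mapping.map (\<lambda>x. c * x) p"

definition bilinear_map ::
  "('k::field \<Rightarrow> 'v::ab_group_add \<Rightarrow> 'v) \<Rightarrow> ('k \<Rightarrow> 'w::ab_group_add \<Rightarrow> 'w)
    \<Rightarrow> ('k \<Rightarrow> 'u::ab_group_add \<Rightarrow> 'u) \<Rightarrow> ('v \<Rightarrow> 'w \<Rightarrow> 'u) \<Rightarrow> bool" where
  "bilinear_map sV sW sU f \<longleftrightarrow>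
    (\<forall>v. Vector_Spaces.linear sW sU (\<lambda>w. f v w)) \<and> (\<forall>w. Vector_Spaces.linear sV sU (\<lambda>v. f v w))"

definition tensor_relations ::
  "('k::field \<Rightarrow> 'v::ab_group_add \<Rightarrow> 'v) \<Rightarrow> ('k \<Rightarrow> 'w::ab_group_add \<Rightarrow> 'w)
    \<Rightarrow> ('v \<times> 'w \<Rightarrow>\<^sub>0 'k) set" where
  "tensor_relations sV sW =
      {Poly_Mapping.single (v + v', w) 1 - Poly_Mapping.single (v, w) 1
        - Poly_Mapping.single (v', w) 1 | v v' w. True}
    \<union> {Poly_Mapping.single (v, w + w') 1 - Poly_Mapping.single (v, w) 1
        - Poly_Mapping.single (v, w') 1 | v w w'. True}
    \<union> {Poly_Mapping.single (sV c v, w) 1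
        - free_scale c (Poly_Mapping.single (v, w) 1) | c v w. True}
    \<union> {Poly_Mapping.single (v, sW c w) 1
        - free_scale c (Poly_Mapping.single (v, w) 1) | c v w. True}"

definition tensor_nf ::
  "('k::field \<Rightarrow> 'v::ab_group_add \<Rightarrow> 'v) \<Rightarrow> ('k \<Rightarrow> 'w::ab_group_add \<Rightarrow> 'w)
    \<Rightarrow> ('v \<times> 'w \<Rightarrow>\<^sub>0 'k) \<Rightarrow> ('v \<times> 'w \<Rightarrow>\<^sub>0 'k)" where
  "tensor_nf sV sW = (SOME f. Vector_Spaces.linear free_scale free_scale f
      \<and> (\<forall>x. f x = 0 \<longleftrightarrow> x \<in> module.span free_scale (tensor_relations sV sW))
      \<and> (\<forall>x. f (f x) = f x))"

definition tensor_space ::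
  "('k::field \<Rightarrow> 'v::ab_group_add \<Rightarrow> 'v) \<Rightarrow> ('k \<Rightarrow> 'w::ab_group_add \<Rightarrow> 'w)
    \<Rightarrow> ('v \<times> 'w \<Rightarrow>\<^sub>0 'k) set" where
  "tensor_space sV sW = range (tensor_nf sV sW)"

definition tensor ::
  "('k::field \<Rightarrow> 'v::ab_group_add \<Rightarrow> 'v) \<Rightarrow> ('k \<Rightarrow> 'w::ab_group_add \<Rightarrow> 'w)
    \<Rightarrow> 'v \<Rightarrow> 'w \<Rightarrow> ('v \<times> 'w \<Rightarrow>\<^sub>0 'k)" where
  "tensor sV sW v w = tensor_nf sV sW (Poly_Mapping.single (v, w) 1)"

text \<open>
  The linear map on the tensor product induced by a bilinear map \<open>f\<close> with values in the space
  with scalar multiplication \<open>sU\<close>. In Sweedler notation, \<open>tensor_lift sU f t\<close> is the sum of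
  \<open>f t\<^sub>1 t\<^sub>2\<close> where \<open>t\<close> is the sum of \<open>t\<^sub>1 \<otimes> t\<^sub>2\<close>.
\<close>

definition tensor_lift ::
  "('k::field \<Rightarrow> 'u::ab_group_add \<Rightarrow> 'u) \<Rightarrow> ('v \<Rightarrow> 'w \<Rightarrow> 'u) \<Rightarrow> ('v \<times> 'w \<Rightarrow>\<^sub>0 'k) \<Rightarrow> 'u" where
  "tensor_lift sU f t =
    (\<Sum>p\<in>Poly_Mapping.keys t. sU (Poly_Mapping.lookup t p) (f (fst p) (snd p)))"

text \<open>
  \<open>tensor_map sV sW f g\<close> is \<open>f \<otimes> g\<close> with values in \<open>V \<otimes> W\<close>, and \<open>tensor_assoc sU sV sW\<close> is the
  canonical map from \<open>(U \<otimes> V) \<otimes> W\<close> to \<open>U \<otimes> (V \<otimes> W)\<close>. A factor that is itself a tensor product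
  has the scalar multiplication \<^const>\<open>free_scale\<close>; as tensoring over a field preserves
  injectivity, nothing is identified or separated by using the ambient free space there.
\<close>

definition tensor_map ::
  "('k::field \<Rightarrow> 'v::ab_group_add \<Rightarrow> 'v) \<Rightarrow> ('k \<Rightarrow> 'w::ab_group_add \<Rightarrow> 'w)
    \<Rightarrow> ('x \<Rightarrow> 'v) \<Rightarrow> ('y \<Rightarrow> 'w) \<Rightarrow> ('x \<times> 'y \<Rightarrow>\<^sub>0 'k) \<Rightarrow> ('v \<times> 'w \<Rightarrow>\<^sub>0 'k)" where
  "tensor_map sV sW f g = tensor_lift free_scale (\<lambda>x y. tensor sV sW (f x) (g y))"

definition tensor_assoc ::
  "('k::field \<Rightarrow> 'u::ab_group_add \<Rightarrow> 'u) \<Rightarrow> ('k \<Rightarrow> 'v::ab_group_add \<Rightarrow> 'v)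
    \<Rightarrow> ('k \<Rightarrow> 'w::ab_group_add \<Rightarrow> 'w)
    \<Rightarrow> (('u \<times> 'v \<Rightarrow>\<^sub>0 'k) \<times> 'w \<Rightarrow>\<^sub>0 'k) \<Rightarrow> ('u \<times> ('v \<times> 'w \<Rightarrow>\<^sub>0 'k) \<Rightarrow>\<^sub>0 'k)" where
  "tensor_assoc sU sV sW = tensor_lift free_scale
    (\<lambda>t w. tensor_lift free_scale (\<lambda>u v. tensor sU free_scale u (tensor sV sW v w)) t)"

definition linear_to_tensor ::
  "('k::field \<Rightarrow> 'u::ab_group_add \<Rightarrow> 'u) \<Rightarrow> ('k \<Rightarrow> 'v::ab_group_add \<Rightarrow> 'v)
    \<Rightarrow> ('k \<Rightarrow> 'w::ab_group_add \<Rightarrow> 'w) \<Rightarrow> ('u \<Rightarrow> ('v \<times> 'w \<Rightarrow>\<^sub>0 'k)) \<Rightarrow> bool" where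
  "linear_to_tensor sU sV sW f \<longleftrightarrow>
    Vector_Spaces.linear sU free_scale f \<and> range f \<subseteq> tensor_space sV sW"

lemma lookup_free_scale [simp]:
  "Poly_Mapping.lookup (free_scale c p) x = c * Poly_Mapping.lookup p x"
  by (simp add: free_scale_def Poly_Mapping.map.rep_eq when_def)

lemma vector_space_free_scale: "vector_space (free_scale :: 'k::field \<Rightarrow> ('x \<Rightarrow>\<^sub>0 'k) \<Rightarrow> _)"
  by unfold_locales (auto intro!: poly_mapping_eqI simp: lookup_add algebra_simps)

interpretation free: vector_space "free_scale :: 'k::field \<Rightarrow> ('x \<Rightarrow>\<^sub>0 'k) \<Rightarrow> _"
  by (rule vector_space_free_scale)

lemma linearI_field:
  assumes "vector_space s1" "vector_space s2"
    and "\<And>x y. f (x + y) = f x + f y" "\<And>c x. f (s1 c x) = s2 c (f x)"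
  shows "Vector_Spaces.linear s1 s2 f"
  by (simp add: Vector_Spaces.linear_iff assms)

lemma linearD_field:
  assumes "Vector_Spaces.linear s1 s2 f"
  shows "vector_space s1" "vector_space s2" "f (x + y) = f x + f y" "f (s1 c x) = s2 c (f x)"
    "f (x - y) = f x - f y" "f 0 = 0"
proof -
  interpret f: Vector_Spaces.linear s1 s2 f by fact
  show "vector_space s1" "vector_space s2" by unfold_locales
  show "f (x + y) = f x + f y" "f (s1 c x) = s2 c (f x)" "f (x - y) = f x - f y" "f 0 = 0"
    by (rule f.add f.scale f.diff f.zero)+
qed

lemma free_projection_exists:
  fixes N :: "('x \<Rightarrow>\<^sub>0 'k::field) set"
  shows "\<exists>f. Vector_Spaces.linear free_scale free_scale f
      \<and> (\<forall>x. f x = 0 \<longleftrightarrow> x \<in> free.span N) \<and> (\<forall>x. f (f x) = f x)"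
proof -
  interpret p: vector_space_pair "free_scale :: 'k \<Rightarrow> ('x \<Rightarrow>\<^sub>0 'k) \<Rightarrow> _"
    "free_scale :: 'k \<Rightarrow> ('x \<Rightarrow>\<^sub>0 'k) \<Rightarrow> _" ..
  obtain B where B: "B \<subseteq> free.span N" "free.independent B" "free.span N \<subseteq> free.span B"
    using free.maximal_independent_subset[of "free.span N"] by blast
  have spB: "free.span B = free.span N"
    using B by (simp add: free.span_minimal subset_antisym)
  define g where "g = p.construct B id"
  have lg: "Vector_Spaces.linear free_scale free_scale g"
    unfolding g_def by (rule p.linear_construct[OF B(2)])
  have gid: "g x = x" if "x \<in> free.span B" for x
  proof (rule p.linear_eq_on[OF lg _ that, where g = "\<lambda>x. x"])
    show "Vector_Spaces.linear free_scale free_scale (\<lambda>x::'x \<Rightarrow>\<^sub>0 'k. x)"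
      by (rule linearI_field) (auto intro: vector_space_free_scale)
    show "g b = b" if "b \<in> B" for b
      using p.construct_basis[OF B(2) that, of id] by (simp add: g_def)
  qed
  have gin: "g x \<in> free.span B" for x
    using p.construct_in_span[OF B(2), of id x] by (simp add: g_def)
  have "Vector_Spaces.linear free_scale free_scale (\<lambda>x. x - g x)"
    by (rule linearI_field)
      (auto intro: vector_space_free_scale simp: linearD_field[OF lg] free.scale_right_diff_distrib)
  moreover have "x - g x = 0 \<longleftrightarrow> x \<in> free.span N" for x
    using gid gin spB by (metis eq_iff_diff_eq_0)
  moreover have "(x - g x) - g (x - g x) = x - g x" for x
    by (simp add: linearD_field(5)[OF lg] gid[OF gin])
  ultimately show ?thesis by blast
qed

lemma tensor_nf:
  shows linear_tensor_nf: "Vector_Spaces.linear free_scale free_scale (tensor_nf sV sW)"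
    and tensor_nf_eq_0_iff:
      "tensor_nf sV sW x = 0 \<longleftrightarrow> x \<in> free.span (tensor_relations sV sW)"
    and tensor_nf_idem: "tensor_nf sV sW (tensor_nf sV sW x) = tensor_nf sV sW x"
  using someI_ex[OF free_projection_exists[of "tensor_relations sV sW"]]
  unfolding tensor_nf_def[symmetric] by blast+

lemma tensor_space_iff: "t \<in> tensor_space sV sW \<longleftrightarrow> tensor_nf sV sW t = t"
  by (auto simp: tensor_space_def tensor_nf_idem) (metis rangeI)

lemma tensor_in_space [simp]: "tensor sV sW v w \<in> tensor_space sV sW"
  by (simp add: tensor_def tensor_space_def)

lemma subspace_tensor_space: "free.subspace (tensor_space sV sW)"
  by (auto simp: free.subspace_def tensor_space_iff linearD_field[OF linear_tensor_nf])

lemma bilinear_map_tensor: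
  assumes "vector_space sV" "vector_space sW"
  shows "bilinear_map sV sW free_scale (tensor sV sW)"
proof -
  note l = linearD_field[OF linear_tensor_nf[of sV sW]]
  have z: "tensor_nf sV sW r = 0" if "r \<in> tensor_relations sV sW" for r
    using that by (simp add: tensor_nf_eq_0_iff free.span_base)
  have "tensor sV sW (v + v') w - tensor sV sW v w - tensor sV sW v' w = 0" for v v' w
    unfolding tensor_def l(5)[symmetric] by (rule z) (unfold tensor_relations_def, blast)
  moreover have "tensor sV sW v (w + w') - tensor sV sW v w - tensor sV sW v w' = 0" for v w w'
    unfolding tensor_def l(5)[symmetric] by (rule z) (unfold tensor_relations_def, blast)
  moreover have "tensor sV sW (sV c v) w - free_scale c (tensor sV sW v w) = 0" for c v w
    unfolding tensor_def l(5)[symmetric] l(4)[symmetric]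
    by (rule z) (unfold tensor_relations_def, blast)
  moreover have "tensor sV sW v (sW c w) - free_scale c (tensor sV sW v w) = 0" for c v w
    unfolding tensor_def l(5)[symmetric] l(4)[symmetric]
    by (rule z) (unfold tensor_relations_def, blast)
  ultimately show ?thesis
    unfolding bilinear_map_def using assms
    by (auto intro!: linearI_field vector_space_free_scale simp: diff_diff_eq)
qed

lemma tensor_lift_superset:
  assumes "vector_space sU" "finite S" "Poly_Mapping.keys t \<subseteq> S"
  shows "tensor_lift sU f t = (\<Sum>p\<in>S. sU (Poly_Mapping.lookup t p) (f (fst p) (snd p)))"
proof -
  interpret vector_space sU by fact
  show ?thesis unfolding tensor_lift_def
    by (rule sum.mono_neutral_left) (use assms in \<open>auto simp: in_keys_iff\<close>)
qed

lemma linear_tensor_lift: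
  fixes sU :: "'k::field \<Rightarrow> 'u::ab_group_add \<Rightarrow> 'u" and f :: "'v \<Rightarrow> 'w \<Rightarrow> 'u"
  assumes "vector_space sU"
  shows "Vector_Spaces.linear free_scale sU (tensor_lift sU f)"
proof -
  interpret U: vector_space sU by fact
  show ?thesis
  proof (rule linearI_field[OF vector_space_free_scale assms])
    fix x y :: "'v \<times> 'w \<Rightarrow>\<^sub>0 'k" and c
    let ?S = "Poly_Mapping.keys x \<union> Poly_Mapping.keys y"
    show "tensor_lift sU f (x + y) = tensor_lift sU f x + tensor_lift sU f y"
      using Poly_Mapping.keys_add[of x y]
      by (simp add: tensor_lift_superset[OF assms, of ?S] lookup_add U.scale_left_distrib
          sum.distrib)
    have "Poly_Mapping.keys (free_scale c x) \<subseteq> Poly_Mapping.keys x"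
      by (auto simp: in_keys_iff)
    then show "tensor_lift sU f (free_scale c x) = sU c (tensor_lift sU f x)"
      by (simp add: tensor_lift_superset[OF assms, of "Poly_Mapping.keys x"] U.scale_sum_right)
  qed
qed

lemma tensor_lift_single:
  assumes "vector_space sU"
  shows "tensor_lift sU f (Poly_Mapping.single (v, w) 1) = f v w"
proof -
  interpret vector_space sU by fact
  show ?thesis by (simp add: tensor_lift_def)
qed

lemma tensor_lift_relation:
  assumes f: "bilinear_map sV sW sU f" and x: "x \<in> free.span (tensor_relations sV sW)"
  shows "tensor_lift sU f x = 0"
proof -
  have f1: "Vector_Spaces.linear sW sU (\<lambda>w. f v w)"
    and f2: "Vector_Spaces.linear sV sU (\<lambda>v. f v w)" for v w
    using f by (auto simp: bilinear_map_def)
  note U = linearD_field(2)[OF f1]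
  note l = linearD_field[OF linear_tensor_lift[OF U, of f]]
  interpret U: vector_space sU by (rule U)
  show ?thesis using x
  proof (induction rule: free.span_induct_alt)
    case base
    show ?case by (simp add: l(6))
  next
    case (step c r y)
    have "tensor_lift sU f r = 0"
      using step(1) unfolding tensor_relations_def
      by (auto simp: l tensor_lift_single[OF U] linearD_field(3,4)[OF f1] linearD_field(3,4)[OF f2])
    then show ?case using step by (simp add: l)
  qed
qed

lemma tensor_lift_nf:
  assumes f: "bilinear_map sV sW sU f"
  shows "tensor_lift sU f (tensor_nf sV sW x) = tensor_lift sU f x"
proof -
  have U: "vector_space sU"
    using f by (auto simp: bilinear_map_def dest: linearD_field(2))
  have "tensor_nf sV sW (tensor_nf sV sW x - x) = 0"
    by (simp add: linearD_field(5)[OF linear_tensor_nf] tensor_nf_idem)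
  then have "tensor_lift sU f (tensor_nf sV sW x - x) = 0"
    using tensor_lift_relation[OF f] by (simp add: tensor_nf_eq_0_iff)
  then show ?thesis by (simp add: linearD_field(5)[OF linear_tensor_lift[OF U]])
qed

lemma tensor_lift_tensor:
  assumes "bilinear_map sV sW sU f"
  shows "tensor_lift sU f (tensor sV sW v w) = f v w"
proof -
  have "vector_space sU"
    using assms by (auto simp: bilinear_map_def dest: linearD_field(2))
  then show ?thesis by (simp add: tensor_def tensor_lift_nf[OF assms] tensor_lift_single)
qed

lemma tensor_space_eq_span:
  "tensor_space sV sW = free.span {tensor sV sW v w | v w. True}"
proof
  show "free.span {tensor sV sW v w | v w. True} \<subseteq> tensor_space sV sW"
    by (rule free.span_minimal[OF _ subspace_tensor_space]) auto
next
  let ?P = "free.span {tensor sV sW v w | v w. True}"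
  have "tensor_nf sV sW x \<in> ?P" for x
  proof -
    have "x = tensor_lift free_scale (\<lambda>v w. Poly_Mapping.single (v, w) 1) x"
    proof (rule poly_mapping_eqI)
      fix k
      have "Poly_Mapping.lookup
          (tensor_lift free_scale (\<lambda>v w. Poly_Mapping.single (v, w) 1) x) k
        = (\<Sum>p\<in>Poly_Mapping.keys x.
            Poly_Mapping.lookup x p * (if p = k then 1 else 0))"
        by (auto simp: tensor_lift_def lookup_sum lookup_single when_def intro!: sum.cong)
      also have "\<dots> = Poly_Mapping.lookup x k"
        by (simp add: in_keys_iff if_distrib[of "(*) _"] cong: if_cong)
      finally show "Poly_Mapping.lookup x k = Poly_Mapping.lookup
          (tensor_lift free_scale (\<lambda>v w. Poly_Mapping.single (v, w) 1) x) k" by simp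
    qed
    then have "tensor_nf sV sW x
        = tensor_nf sV sW (tensor_lift free_scale (\<lambda>v w. Poly_Mapping.single (v, w) 1) x)"
      by simp
    also have "\<dots> = (\<Sum>p\<in>Poly_Mapping.keys x.
        free_scale (Poly_Mapping.lookup x p) (tensor sV sW (fst p) (snd p)))"
    proof -
      interpret l: Vector_Spaces.linear free_scale free_scale "tensor_nf sV sW"
        by (rule linear_tensor_nf)
      show ?thesis by (simp add: tensor_lift_def l.sum l.scale tensor_def)
    qed
    also have "\<dots> \<in> ?P"
      by (intro free.span_sum free.span_scale free.span_base) auto
    finally show ?thesis .
  qed
  then show "tensor_space sV sW \<subseteq> ?P" by (auto simp: tensor_space_def)
qed

theorem tensor_universal_property:
  assumes f: "bilinear_map sV sW sU f"
  shows "Vector_Spaces.linear free_scale sU (tensor_lift sU f)"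
    and "tensor_lift sU f (tensor sV sW v w) = f v w"
    and "\<lbrakk>Vector_Spaces.linear free_scale sU h; \<And>v w. h (tensor sV sW v w) = f v w;
      t \<in> tensor_space sV sW\<rbrakk> \<Longrightarrow> h t = tensor_lift sU f t"
proof -
  have U: "vector_space sU"
    using f by (auto simp: bilinear_map_def dest: linearD_field(2))
  show l: "Vector_Spaces.linear free_scale sU (tensor_lift sU f)"
    by (rule linear_tensor_lift[OF U])
  show "tensor_lift sU f (tensor sV sW v w) = f v w" by (rule tensor_lift_tensor[OF f])
  assume h: "Vector_Spaces.linear free_scale sU h" "\<And>v w. h (tensor sV sW v w) = f v w"
    and t: "t \<in> tensor_space sV sW"
  interpret p: vector_space_pair free_scale sU
    by (rule vector_space_pair.intro[OF vector_space_free_scale U])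
  show "h t = tensor_lift sU f t"
    using t unfolding tensor_space_eq_span
    by (rule p.linear_eq_on[OF h(1) l]) (auto simp: h(2) tensor_lift_tensor[OF f])
qed


section \<open>BiHom-structures\<close>

locale bihom_assoc_algebra =
  fixes sA :: "'k::field \<Rightarrow> 'a::ab_group_add \<Rightarrow> 'a"
    and mu :: "'a \<Rightarrow> 'a \<Rightarrow> 'a"
    and alA beA :: "'a \<Rightarrow> 'a"
  assumes bilinear_mu: "bilinear_map sA sA sA mu"
    and linear_alA: "Vector_Spaces.linear sA sA alA"
    and linear_beA: "Vector_Spaces.linear sA sA beA"
    and alA_beA: "alA (beA a) = beA (alA a)"
    and alA_mu: "alA (mu a b) = mu (alA a) (alA b)"
    and beA_mu: "beA (mu a b) = mu (beA a) (beA b)"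
    and mu_assoc: "mu (alA a) (mu b c) = mu (mu a b) (beA c)"

locale bihom_coassoc_coalgebra =
  fixes sA :: "'k::field \<Rightarrow> 'a::ab_group_add \<Rightarrow> 'a"
    and Delta :: "'a \<Rightarrow> ('a \<times> 'a \<Rightarrow>\<^sub>0 'k)"
    and psA omA :: "'a \<Rightarrow> 'a"
  assumes linear_Delta: "linear_to_tensor sA sA sA Delta"
    and linear_psA: "Vector_Spaces.linear sA sA psA"
    and linear_omA: "Vector_Spaces.linear sA sA omA"
    and psA_omA: "psA (omA a) = omA (psA a)"
    and psA_Delta: "tensor_map sA sA psA psA (Delta a) = Delta (psA a)"
    and omA_Delta: "tensor_map sA sA omA omA (Delta a) = Delta (omA a)"
    and Delta_coassoc:
      "tensor_assoc sA sA sA (tensor_map free_scale sA Delta psA (Delta a))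
        = tensor_map sA free_scale omA Delta (Delta a)"

locale infBH_bialgebra =
  bihom_assoc_algebra sA mu alA beA + bihom_coassoc_coalgebra sA Delta psA omA
  for sA :: "'k::field \<Rightarrow> 'a::ab_group_add \<Rightarrow> 'a"
    and lam :: 'k
    and mu :: "'a \<Rightarrow> 'a \<Rightarrow> 'a"
    and Delta :: "'a \<Rightarrow> ('a \<times> 'a \<Rightarrow>\<^sub>0 'k)"
    and alA beA psA omA :: "'a \<Rightarrow> 'a" +
  assumes alA_psA: "alA (psA a) = psA (alA a)"
    and alA_omA: "alA (omA a) = omA (alA a)"
    and beA_psA: "beA (psA a) = psA (beA a)"
    and beA_omA: "beA (omA a) = omA (beA a)"
    and alA_Delta: "tensor_map sA sA alA alA (Delta a) = Delta (alA a)"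
    and beA_Delta: "tensor_map sA sA beA beA (Delta a) = Delta (beA a)"
    and psA_mu: "psA (mu a b) = mu (psA a) (psA b)"
    and omA_mu: "omA (mu a b) = mu (omA a) (omA b)"
    and Delta_mu:
      "Delta (mu a b)
        = tensor_lift free_scale (\<lambda>b1 b2. tensor sA sA (mu (omA a) b1) (beA b2)) (Delta b)
        + tensor_lift free_scale (\<lambda>a1 a2. tensor sA sA (alA a1) (mu a2 (psA b))) (Delta a)
        + free_scale lam (tensor sA sA (alA (omA a)) (beA (psA b)))"

locale bihom_bimodule = bihom_assoc_algebra sA mu alA beA
  for sA :: "'k::field \<Rightarrow> 'a::ab_group_add \<Rightarrow> 'a"
    and mu :: "'a \<Rightarrow> 'a \<Rightarrow> 'a"
    and alA beA :: "'a \<Rightarrow> 'a" +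
  fixes sM :: "'k \<Rightarrow> 'm::ab_group_add \<Rightarrow> 'm"
    and actl :: "'a \<Rightarrow> 'm \<Rightarrow> 'm"
    and actr :: "'m \<Rightarrow> 'a \<Rightarrow> 'm"
    and alM beM :: "'m \<Rightarrow> 'm"
  assumes bilinear_actl: "bilinear_map sA sM sM actl"
    and bilinear_actr: "bilinear_map sM sA sM actr"
    and linear_alM: "Vector_Spaces.linear sM sM alM"
    and linear_beM: "Vector_Spaces.linear sM sM beM"
    and alM_beM: "alM (beM m) = beM (alM m)"
    and alM_actl: "alM (actl a m) = actl (alA a) (alM m)"
    and beM_actl: "beM (actl a m) = actl (beA a) (beM m)"
    and alM_actr: "alM (actr m a) = actr (alM m) (alA a)"
    and beM_actr: "beM (actr m a) = actr (beM m) (beA a)"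
    and actl_actl: "actl (alA a) (actl a' m) = actl (mu a a') (beM m)"
    and actr_actr: "actr (alM m) (mu a a') = actr (actr m a) (beA a')"
    and actl_actr: "actl (alA a) (actr m a') = actr (actl a m) (beA a')"

locale bihom_bicomodule = bihom_coassoc_coalgebra sA Delta psA omA
  for sA :: "'k::field \<Rightarrow> 'a::ab_group_add \<Rightarrow> 'a"
    and Delta :: "'a \<Rightarrow> ('a \<times> 'a \<Rightarrow>\<^sub>0 'k)"
    and psA omA :: "'a \<Rightarrow> 'a" +
  fixes sM :: "'k \<Rightarrow> 'm::ab_group_add \<Rightarrow> 'm"
    and rho :: "'m \<Rightarrow> ('a \<times> 'm \<Rightarrow>\<^sub>0 'k)"
    and phi :: "'m \<Rightarrow> ('m \<times> 'a \<Rightarrow>\<^sub>0 'k)"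
    and psM omM :: "'m \<Rightarrow> 'm"
  assumes linear_rho: "linear_to_tensor sM sA sM rho"
    and linear_phi: "linear_to_tensor sM sM sA phi"
    and linear_psM: "Vector_Spaces.linear sM sM psM"
    and linear_omM: "Vector_Spaces.linear sM sM omM"
    and psM_omM: "psM (omM m) = omM (psM m)"
    and psM_rho: "tensor_map sA sM psA psM (rho m) = rho (psM m)"
    and omM_rho: "tensor_map sA sM omA omM (rho m) = rho (omM m)"
    and psM_phi: "tensor_map sM sA psM psA (phi m) = phi (psM m)"
    and omM_phi: "tensor_map sM sA omM omA (phi m) = phi (omM m)"
    and rho_rho:
      "tensor_map sA free_scale omA rho (rho m)
        = tensor_assoc sA sA sM (tensor_map free_scale sM Delta psM (rho m))"
    and phi_phi:
      "tensor_map sM free_scale omM Delta (phi m)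
        = tensor_assoc sM sA sA (tensor_map free_scale sA phi psA (phi m))"
    and rho_phi:
      "tensor_map sA free_scale omA phi (rho m)
        = tensor_assoc sA sM sA (tensor_map free_scale sA rho psA (phi m))"

locale infBH_Hopf_bimodule =
  infBH_bialgebra sA lam mu Delta alA beA psA omA
  + bihom_bimodule sA mu alA beA sM actl actr alM beM
  + bihom_bicomodule sA Delta psA omA sM rho phi psM omM
  for sA :: "'k::field \<Rightarrow> 'a::ab_group_add \<Rightarrow> 'a"
    and lam :: 'k
    and mu :: "'a \<Rightarrow> 'a \<Rightarrow> 'a"
    and Delta :: "'a \<Rightarrow> ('a \<times> 'a \<Rightarrow>\<^sub>0 'k)"
    and alA beA psA omA :: "'a \<Rightarrow> 'a"
    and sM :: "'k \<Rightarrow> 'm::ab_group_add \<Rightarrow> 'm"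
    and actl :: "'a \<Rightarrow> 'm \<Rightarrow> 'm"
    and actr :: "'m \<Rightarrow> 'a \<Rightarrow> 'm"
    and rho :: "'m \<Rightarrow> ('a \<times> 'm \<Rightarrow>\<^sub>0 'k)"
    and phi :: "'m \<Rightarrow> ('m \<times> 'a \<Rightarrow>\<^sub>0 'k)"
    and alM beM psM omM :: "'m \<Rightarrow> 'm" +
  assumes alM_psM: "alM (psM m) = psM (alM m)"
    and alM_omM: "alM (omM m) = omM (alM m)"
    and beM_psM: "beM (psM m) = psM (beM m)"
    and beM_omM: "beM (omM m) = omM (beM m)"
    and rho_actl:
      "rho (actl a m)
        = tensor_lift free_scale (\<lambda>x n. tensor sA sM (mu (omA a) x) (beM n)) (rho m)
        + tensor_lift free_scale (\<lambda>a1 a2. tensor sA sM (alA a1) (actl a2 (psM m))) (Delta a)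
        + free_scale lam (tensor sA sM (alA (omA a)) (beM (psM m)))"
    and phi_actr:
      "phi (actr m a)
        = tensor_lift free_scale (\<lambda>a1 a2. tensor sM sA (actr (omM m) a1) (beA a2)) (Delta a)
        + tensor_lift free_scale (\<lambda>n x. tensor sM sA (alM n) (mu x (psA a))) (phi m)
        + free_scale lam (tensor sM sA (alM (omM m)) (beA (psA a)))"
    and phi_actl:
      "phi (actl a m)
        = tensor_lift free_scale (\<lambda>n x. tensor sM sA (actl (omA a) n) (beA x)) (phi m)"
    and rho_actr:
      "rho (actr m a)
        = tensor_lift free_scale (\<lambda>x n. tensor sA sM (alA x) (actr n (psA a))) (rho m)"

locale bihom_preLie_algebra =
  fixes sA :: "'k::field \<Rightarrow> 'a::ab_group_add \<Rightarrow> 'a"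
    and opA :: "'a \<Rightarrow> 'a \<Rightarrow> 'a"
    and al be :: "'a \<Rightarrow> 'a"
  assumes bilinear_opA: "bilinear_map sA sA sA opA"
    and linear_al: "Vector_Spaces.linear sA sA al"
    and linear_be: "Vector_Spaces.linear sA sA be"
    and al_be: "al (be a) = be (al a)"
    and al_opA: "al (opA a b) = opA (al a) (al b)"
    and be_opA: "be (opA a b) = opA (be a) (be b)"
    and preLie:
      "opA (al (be a)) (opA (al b) c) - opA (opA (be a) (al b)) (be c)
        = opA (al (be b)) (opA (al a) c) - opA (opA (be b) (al a)) (be c)"

locale bihom_preLie_bimodule = bihom_preLie_algebra sA opA al be
  for sA :: "'k::field \<Rightarrow> 'a::ab_group_add \<Rightarrow> 'a"
    and opA :: "'a \<Rightarrow> 'a \<Rightarrow> 'a"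
    and al be :: "'a \<Rightarrow> 'a" +
  fixes sM :: "'k \<Rightarrow> 'm::ab_group_add \<Rightarrow> 'm"
    and opl :: "'a \<Rightarrow> 'm \<Rightarrow> 'm"
    and opr :: "'m \<Rightarrow> 'a \<Rightarrow> 'm"
    and al' be' :: "'m \<Rightarrow> 'm"
  assumes bilinear_opl: "bilinear_map sA sM sM opl"
    and bilinear_opr: "bilinear_map sM sA sM opr"
    and linear_al': "Vector_Spaces.linear sM sM al'"
    and linear_be': "Vector_Spaces.linear sM sM be'"
    and al'_be': "al' (be' m) = be' (al' m)"
    and al'_opl: "al' (opl a m) = opl (al a) (al' m)"
    and al'_opr: "al' (opr m a) = opr (al' m) (al a)"
    and be'_opl: "be' (opl a m) = opl (be a) (be' m)"
    and be'_opr: "be' (opr m a) = opr (be' m) (be a)"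
    and preLie_left:
      "opl (al (be a)) (opl (al b) m) - opl (opA (be a) (al b)) (be' m)
        = opl (al (be b)) (opl (al a) m) - opl (opA (be b) (al a)) (be' m)"
    and preLie_right:
      "opl (al (be a)) (opr (al' m) c) - opr (opl (be a) (al' m)) (be c)
        = opr (al' (be' m)) (opA (al a) c) - opr (opr (be' m) (al a)) (be c)"


section \<open>The induced operations\<close>

definition star_A ::
  "('k::field \<Rightarrow> 'a::ab_group_add \<Rightarrow> 'a) \<Rightarrow> ('a \<Rightarrow> 'a \<Rightarrow> 'a) \<Rightarrow> ('a \<Rightarrow> ('a \<times> 'a \<Rightarrow>\<^sub>0 'k))
    \<Rightarrow> ('a \<Rightarrow> 'a) \<Rightarrow> ('a \<Rightarrow> 'a) \<Rightarrow> ('a \<Rightarrow> 'a) \<Rightarrow> ('a \<Rightarrow> 'a) \<Rightarrow> 'a \<Rightarrow> 'a \<Rightarrow> 'a" where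
  "star_A sA mu Delta alA beA psA omA a b =
    tensor_lift sA
      (\<lambda>b1 b2. mu (mu (beA (beA (psA b1))) (alA a)) (alA (alA (beA (omA b2))))) (Delta b)"

definition star_left ::
  "('a::ab_group_add \<Rightarrow> 'a \<Rightarrow> 'a) \<Rightarrow> ('a \<Rightarrow> 'a) \<Rightarrow> ('a \<Rightarrow> 'a) \<Rightarrow> ('a \<Rightarrow> 'a) \<Rightarrow> ('a \<Rightarrow> 'a)
    \<Rightarrow> ('k::field \<Rightarrow> 'm::ab_group_add \<Rightarrow> 'm) \<Rightarrow> ('a \<Rightarrow> 'm \<Rightarrow> 'm) \<Rightarrow> ('m \<Rightarrow> 'a \<Rightarrow> 'm)
    \<Rightarrow> ('m \<Rightarrow> ('a \<times> 'm \<Rightarrow>\<^sub>0 'k)) \<Rightarrow> ('m \<Rightarrow> ('m \<times> 'a \<Rightarrow>\<^sub>0 'k))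
    \<Rightarrow> ('m \<Rightarrow> 'm) \<Rightarrow> ('m \<Rightarrow> 'm) \<Rightarrow> ('m \<Rightarrow> 'm) \<Rightarrow> ('m \<Rightarrow> 'm) \<Rightarrow> 'a \<Rightarrow> 'm \<Rightarrow> 'm" where
  "star_left mu alA beA psA omA sM actl actr rho phi alM beM psM omM a m =
    tensor_lift sM
      (\<lambda>x n. actl (mu (beA (beA (psA x))) (alA a)) (alM (alM (beM (omM n))))) (rho m)
    + tensor_lift sM
      (\<lambda>n x. actr (actr (beM (beM (psM n))) (alA a)) (alA (alA (beA (omA x))))) (phi m)"

definition star_right ::
  "('a::ab_group_add \<Rightarrow> ('a \<times> 'a \<Rightarrow>\<^sub>0 'k::field)) \<Rightarrow> ('a \<Rightarrow> 'a) \<Rightarrow> ('a \<Rightarrow> 'a) \<Rightarrow> ('a \<Rightarrow> 'a)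
    \<Rightarrow> ('a \<Rightarrow> 'a) \<Rightarrow> ('k \<Rightarrow> 'm::ab_group_add \<Rightarrow> 'm) \<Rightarrow> ('a \<Rightarrow> 'm \<Rightarrow> 'm) \<Rightarrow> ('m \<Rightarrow> 'a \<Rightarrow> 'm)
    \<Rightarrow> ('m \<Rightarrow> 'm) \<Rightarrow> 'm \<Rightarrow> 'a \<Rightarrow> 'm" where
  "star_right Delta alA beA psA omA sM actl actr alM m a =
    tensor_lift sM
      (\<lambda>a1 a2. actr (actl (beA (beA (psA a1))) (alM m)) (alA (alA (beA (omA a2))))) (Delta a)"

section \<open>Compatibility of the structure maps with a Hopf bimodule\<close>

text \<open>
  \<^const>\<open>infBH_Hopf_bimodule\<close> does not ask that \<open>\<alpha>\<^sub>M\<close> and \<open>\<beta>\<^sub>M\<close> respect the coactions, or that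
  \<open>\<psi>\<^sub>M\<close> and \<open>\<omega>\<^sub>M\<close> respect the actions (\<^const>\<open>infBH_bialgebra\<close> does ask the corresponding
  conditions on \<open>A\<close>). Without these conditions the maps \<open>\<alpha>\<^sub>M\<^sup>2\<beta>\<^sub>M\<close> and \<open>\<alpha>\<^sub>M\<^sup>2\<beta>\<^sub>M\<^sup>2\<psi>\<^sub>M\<omega>\<^sub>M\<close> need not
  respect the induced operations. The following example, over an arbitrary field, has \<open>A = K\<close>,
  \<open>\<Delta> = 0\<close>, \<open>\<lambda> = 0\<close>, \<open>M = K\<^sup>2\<close>, right action and right coaction zero, \<open>\<rho>(x, y) = 1 \<otimes> (y, 0)\<close>,
  \<open>\<alpha>\<^sub>M(x, y) = (x, 0)\<close> and identities for all other structure maps.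
\<close>

definition scale2 :: "'k::field \<Rightarrow> 'k \<times> 'k \<Rightarrow> 'k \<times> 'k" where
  "scale2 c m = (c * fst m, c * snd m)"

lemma vector_space_mult: "vector_space ((*) :: 'k::field \<Rightarrow> 'k \<Rightarrow> 'k)"
  by unfold_locales (simp_all add: algebra_simps)

lemma vector_space_scale2: "vector_space (scale2 :: 'k::field \<Rightarrow> _)"
  by unfold_locales (simp_all add: scale2_def algebra_simps)

lemma Hopf_bimodule_not_preLie_bimodule:
  fixes rho :: "'k::field \<times> 'k \<Rightarrow> ('k \<times> ('k \<times> 'k) \<Rightarrow>\<^sub>0 'k)"
    and alM :: "'k \<times> 'k \<Rightarrow> 'k \<times> 'k"
  defines "rho \<equiv> (\<lambda>m. tensor (*) scale2 1 (snd m, 0))"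
    and "alM \<equiv> (\<lambda>m. (fst m, 0))"
  shows "infBH_bialgebra (*) 0 (*) (\<lambda>_::'k. 0) id id id id"
    and "infBH_Hopf_bimodule (*) 0 (*) (\<lambda>_::'k. 0) id id id id
      scale2 scale2 (\<lambda>_ _. 0) rho (\<lambda>_. 0) alM id id id"
    and "\<not> bihom_preLie_bimodule
      (*) (star_A (*) (*) (\<lambda>_::'k. 0) id id id id)
      (id \<circ> id \<circ> id) (id \<circ> id \<circ> id \<circ> id \<circ> id \<circ> id)
      scale2 (star_left (*) id id id id scale2 scale2 (\<lambda>_ _. 0) rho (\<lambda>_. 0) alM id id id)
      (star_right (\<lambda>_::'k. 0) id id id id scale2 scale2 (\<lambda>_ _. 0) alM)
      (alM \<circ> alM \<circ> id) (alM \<circ> alM \<circ> id \<circ> id \<circ> id \<circ> id)"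
proof -
  note vs = vector_space_mult vector_space_scale2 vector_space_free_scale
  have lift0 [simp]: "tensor_lift s f 0 = 0" for s :: "'k \<Rightarrow> 'u::ab_group_add \<Rightarrow> 'u"
      and f :: "'v \<Rightarrow> 'w \<Rightarrow> 'u"
    by (simp add: tensor_lift_def)
  have z [simp]: "0 \<in> tensor_space s t" for s :: "'k \<Rightarrow> 'v::ab_group_add \<Rightarrow> 'v"
      and t :: "'k \<Rightarrow> 'w::ab_group_add \<Rightarrow> 'w"
    by (rule free.subspace_0[OF subspace_tensor_space])
  have lin0: "Vector_Spaces.linear s t (\<lambda>_. 0)" if "vector_space s" "vector_space t"
    for s :: "'k \<Rightarrow> 'v::ab_group_add \<Rightarrow> 'v" and t :: "'k \<Rightarrow> 'w::ab_group_add \<Rightarrow> 'w"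
  proof -
    interpret vector_space t by fact
    show ?thesis by (rule linearI_field) (use that in auto)
  qed
  have linid: "Vector_Spaces.linear s s id" if "vector_space s"
    for s :: "'k \<Rightarrow> 'v::ab_group_add \<Rightarrow> 'v"
    by (rule linearI_field) (use that in auto)
  have bil: "bilinear_map (*) (*) (*) ((*) :: 'k \<Rightarrow> _)"
    "bilinear_map (*) scale2 scale2 (scale2 :: 'k \<Rightarrow> _)"
    "bilinear_map scale2 (*) scale2 (\<lambda>_ (_::'k). 0)"
    unfolding bilinear_map_def
    by (auto intro!: linearI_field vs lin0 simp: algebra_simps scale2_def)
  note bt = bilinear_map_tensor[OF vs(1) vs(2)]
  have t1: "tensor (*) scale2 a (m + n) = tensor (*) scale2 a m + tensor (*) scale2 a n"
    "tensor (*) scale2 a (scale2 c m) = free_scale c (tensor (*) scale2 a m)"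
    "tensor (*) scale2 (c * a) m = free_scale c (tensor (*) scale2 a m)"
    "tensor (*) scale2 a 0 = 0"
    for a c :: 'k and m n
    using bt linearD_field(3,4,6) unfolding bilinear_map_def by metis+
  have t2: "tensor (*) scale2 (a + b) m = tensor (*) scale2 a m + tensor (*) scale2 b m"
    for a b :: 'k and m
    by (rule linearD_field(3)[OF bt[unfolded bilinear_map_def, THEN conjunct2, rule_format]])
  have lrho: "Vector_Spaces.linear scale2 free_scale rho"
  proof (rule linearI_field[OF vs(2,3)])
    show "rho (x + y) = rho x + rho y" for x y
      by (simp add: rho_def t1(1)[symmetric])
    show "rho (scale2 c x) = free_scale c (rho x)" for c x
      by (simp add: rho_def t1(2)[symmetric]) (simp add: scale2_def)
  qed
  have liftrho: "tensor_lift s f (rho m) = f 1 (snd m, 0)" if "bilinear_map (*) scale2 s f"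
    for s :: "'k \<Rightarrow> 'u::ab_group_add \<Rightarrow> 'u" and f m
    unfolding rho_def by (rule tensor_lift_tensor[OF that])
  have bt': "bilinear_map (*) scale2 free_scale
      (\<lambda>x n. tensor (*) scale2 (a * x) (n :: 'k \<times> 'k))" for a :: 'k
    unfolding bilinear_map_def
  proof (intro conjI allI linearI_field vs)
    show "tensor (*) scale2 (a * v) (m + n)
        = tensor (*) scale2 (a * v) m + tensor (*) scale2 (a * v) n" for v and m n :: "'k \<times> 'k"
      by (rule t1(1))
    show "tensor (*) scale2 (a * v) (scale2 c m) = free_scale c (tensor (*) scale2 (a * v) m)"
      for c v and m :: "'k \<times> 'k"
      by (rule t1(2))
    show "tensor (*) scale2 (a * (x + y)) n
        = tensor (*) scale2 (a * x) n + tensor (*) scale2 (a * y) n" for x y and n :: "'k \<times> 'k"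
      by (simp only: distrib_left t2)
    show "tensor (*) scale2 (a * (c * x)) n = free_scale c (tensor (*) scale2 (a * x) n)"
      for c x and n :: "'k \<times> 'k"
      by (simp only: mult.left_commute[of a] t1(3))
  qed
  show bi: "infBH_bialgebra (*) 0 (*) (\<lambda>_::'k. 0) id id id id"
    by unfold_locales
      (auto simp: linear_to_tensor_def tensor_map_def tensor_assoc_def algebra_simps
        intro!: bil lin0 linid vs)
  show "infBH_Hopf_bimodule (*) 0 (*) (\<lambda>_::'k. 0) id id id id
      scale2 scale2 (\<lambda>_ _. 0) rho (\<lambda>_. 0) alM id id id"
  proof -
    have fz: "tensor_lift u f t = 0" if "\<And>v w. f v w = 0" "vector_space u"
      for u :: "'k \<Rightarrow> 'u::ab_group_add \<Rightarrow> 'u" and f :: "'v \<Rightarrow> 'w \<Rightarrow> 'u" and t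
    proof -
      interpret vector_space u by fact
      show ?thesis by (simp add: tensor_lift_def that(1))
    qed
    have tz: "tensor s t x 0 = 0" "tensor s t 0 y = 0" if "vector_space s" "vector_space t"
      for s :: "'k \<Rightarrow> 'v::ab_group_add \<Rightarrow> 'v" and t :: "'k \<Rightarrow> 'w::ab_group_add \<Rightarrow> 'w" and x y
      using bilinear_map_tensor[OF that] linearD_field(6) unfolding bilinear_map_def by metis+
    have lalM: "Vector_Spaces.linear scale2 scale2 alM"
      by (auto intro!: linearI_field vs simp: scale2_def alM_def)
    have rho0: "rho (y, 0) = 0" for y
      by (simp add: rho_def t1(4) zero_prod_def[symmetric])
    have brho: "bilinear_map (*) scale2 free_scale (\<lambda>x n. tensor (*) free_scale x (rho n))"
      unfolding bilinear_map_def
    proof (intro conjI allI)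
      note b = bilinear_map_tensor[OF vs(1) vs(3), unfolded bilinear_map_def]
      show "Vector_Spaces.linear (*) free_scale (\<lambda>v. tensor (*) free_scale v (rho w))" for w
        using b by blast
      show "Vector_Spaces.linear scale2 free_scale (\<lambda>w. tensor (*) free_scale v (rho w))" for v
        using Vector_Spaces.linear_compose[OF lrho b[THEN conjunct1, rule_format, of v]] by (simp add: o_def)
    qed
    have rr: "tensor_map (*) free_scale id rho (rho m) = 0" for m
      by (simp add: tensor_map_def liftrho[OF brho] rho0 tz vs)
    have rid: "tensor_map (*) scale2 id id (rho m) = rho m" for m
      using liftrho[OF bt] by (simp add: tensor_map_def) (simp add: rho_def)
    have tm0: "tensor_map s t f g 0 = 0"
      for s :: "'k \<Rightarrow> 'v::ab_group_add \<Rightarrow> 'v" and t :: "'k \<Rightarrow> 'w::ab_group_add \<Rightarrow> 'w"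
        and f :: "'x \<Rightarrow> 'v" and g :: "'y \<Rightarrow> 'w"
      by (simp add: tensor_map_def)
    have ta0: "tensor_assoc s t u 0 = 0"
      for s :: "'k \<Rightarrow> 'v::ab_group_add \<Rightarrow> 'v" and t :: "'k \<Rightarrow> 'w::ab_group_add \<Rightarrow> 'w"
        and u :: "'k \<Rightarrow> 'x::ab_group_add \<Rightarrow> 'x"
      by (simp add: tensor_assoc_def)
    interpret infBH_bialgebra "(*)" 0 "(*)" "\<lambda>_::'k. 0" id id id id by (rule bi)
    show ?thesis
    proof unfold_locales
      show "linear_to_tensor scale2 (*) scale2 rho"
        using lrho by (auto simp: linear_to_tensor_def rho_def)
      show "linear_to_tensor scale2 scale2 (*) (\<lambda>_::'k \<times> 'k. 0)"
        by (auto simp: linear_to_tensor_def intro!: lin0 vs)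
      show "tensor_map (*) free_scale id rho (rho m)
          = tensor_assoc (*) (*) scale2
              (tensor_map free_scale scale2 (\<lambda>_::'k. 0) id (rho m))" for m
        unfolding rr unfolding tensor_assoc_def tensor_map_def by (simp add: fz tz vs)
      show "tensor_map (*) free_scale id (\<lambda>_::'k \<times> 'k. 0) (rho m)
          = tensor_assoc (*) scale2 (*) (tensor_map free_scale (*) rho id 0)" for m
        unfolding tensor_assoc_def tensor_map_def by (simp add: fz tz vs)
      show "rho (scale2 a m)
          = tensor_lift free_scale (\<lambda>x n. tensor (*) scale2 (id a * x) (id n)) (rho m)
          + tensor_lift free_scale (\<lambda>a1 a2. tensor (*) scale2 (id a1) (scale2 a2 (id m))) 0
          + free_scale 0 (tensor (*) scale2 (id (id a)) (id (id m)))" for a m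
        using liftrho[OF bt', of a m] t1(3)[of a 1]
        by (simp add: linearD_field(4)[OF lrho]) (simp add: rho_def)
      show "rho 0 = tensor_lift free_scale (\<lambda>x n. tensor (*) scale2 (id x) 0) (rho m)" for m
        by (simp add: fz tz vs linearD_field(6)[OF lrho])
    qed (simp_all add: rid bil[unfolded zero_prod_def] tm0 ta0 alM_def scale2_def zero_prod_def
        algebra_simps)
  qed
  show "\<not> bihom_preLie_bimodule
      (*) (star_A (*) (*) (\<lambda>_::'k. 0) id id id id)
      (id \<circ> id \<circ> id) (id \<circ> id \<circ> id \<circ> id \<circ> id \<circ> id)
      scale2 (star_left (*) id id id id scale2 scale2 (\<lambda>_ _. 0) rho (\<lambda>_. 0) alM id id id)
      (star_right (\<lambda>_::'k. 0) id id id id scale2 scale2 (\<lambda>_ _. 0) alM)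
      (alM \<circ> alM \<circ> id) (alM \<circ> alM \<circ> id \<circ> id \<circ> id \<circ> id)"
    (is "\<not> bihom_preLie_bimodule _ _ _ _ _ ?l _ _ _")
  proof
    assume "bihom_preLie_bimodule
      (*) (star_A (*) (*) (\<lambda>_::'k. 0) id id id id)
      (id \<circ> id \<circ> id) (id \<circ> id \<circ> id \<circ> id \<circ> id \<circ> id)
      scale2 ?l
      (star_right (\<lambda>_::'k. 0) id id id id scale2 scale2 (\<lambda>_ _. 0) alM)
      (alM \<circ> alM \<circ> id) (alM \<circ> alM \<circ> id \<circ> id \<circ> id \<circ> id)"
    then have "alM (alM (?l 1 (0, 1))) = ?l 1 (alM (alM (0, 1)))"
      using bihom_preLie_bimodule.al'_opl by fastforce
    moreover have "?l 1 m = (snd m, 0)" for m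
    proof -
      have "bilinear_map (*) scale2 scale2 (\<lambda>x n. scale2 x (alM (alM n)) :: 'k \<times> 'k)"
        unfolding bilinear_map_def
        by (auto intro!: linearI_field vs simp: algebra_simps scale2_def alM_def)
      from liftrho[OF this] show ?thesis
        by (simp add: star_left_def) (simp add: alM_def scale2_def)
    qed
    ultimately show False by (simp add: alM_def)
  qed
qed

end

theory Submission
  imports Defs
begin

text \<open>
  Put \<open>E = A \<oplus> M\<close> with the square-zero product \<open>(a, m)(b, n) = (ab, a \<triangleright> n + m \<triangleleft> b)\<close>, the
  comultiplication \<open>\<Delta> + \<rho> + \<phi>\<close> and the diagonal structure maps. Then \<open>E\<close> is BiHom-associative and
  BiHom-coassociative, and it satisfies the compatibility condition of a \<open>\<lambda>\<close>-infBH-bialgebra modulo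
  \<open>M \<otimes> M\<close>. As \<open>(ux)v = 0\<close> for \<open>u, v \<in> M\<close>, that is enough for the operation
  \<open>x \<star> y = (\<beta>\<^sup>2\<psi>(y\<^sub>1) \<alpha>(x)) \<alpha>\<^sup>2\<beta>\<omega>(y\<^sub>2)\<close> to be BiHom-pre-Lie on \<open>E\<close>: up to the structure maps, the
  associator \<open>x \<star> (y \<star> z) - (x \<star> y) \<star> z\<close> equals
  \<open>z\<^sub>1 y z\<^sub>2 x z\<^sub>3 + z\<^sub>1 x z\<^sub>2 y z\<^sub>3 + \<lambda> (z\<^sub>1 y x z\<^sub>2 + z\<^sub>1 x y z\<^sub>2)\<close>, which is symmetric in \<open>x\<close> and \<open>y\<close>. The
  components of \<open>\<star>\<close> on \<open>E\<close> are the operations \<open>a \<star> b\<close>, \<open>a \<star> m\<close>, \<open>m \<star> a\<close>, so the theorem is the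
  BiHom-pre-Lie identity of \<open>E\<close> with at most one argument in \<open>M\<close>.
\<close>

section \<open>Bilinear maps and Sweedler sums\<close>

lemma bilinear_map_iff:
  "bilinear_map sV sW sU f \<longleftrightarrow> vector_space sV \<and> vector_space sW \<and> vector_space sU \<and>
    (\<forall>v w w'. f v (w + w') = f v w + f v w') \<and> (\<forall>c v w. f v (sW c w) = sU c (f v w)) \<and>
    (\<forall>v v' w. f (v + v') w = f v w + f v' w) \<and> (\<forall>c v w. f (sV c v) w = sU c (f v w))"
  by (auto simp: bilinear_map_def Vector_Spaces.linear_iff)

lemma bilinear_map_zero:
  assumes "bilinear_map sV sW sU f"
  shows "f 0 w = 0" "f v 0 = 0"
  using assms unfolding bilinear_map_def by (auto dest: linearD_field(6))

lemma linear_apply_tensor_lift: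
  assumes "Vector_Spaces.linear sU sX h"
  shows "h (tensor_lift sU F t) = tensor_lift sX (\<lambda>u v. h (F u v)) t"
proof -
  interpret h: Vector_Spaces.linear sU sX h by fact
  show ?thesis by (simp add: tensor_lift_def h.sum h.scale)
qed

lemma tensor_lift_linear:
  assumes "vector_space sU"
  shows "tensor_lift sU F (t + t') = tensor_lift sU F t + tensor_lift sU F t'"
    "tensor_lift sU F (free_scale c t) = sU c (tensor_lift sU F t)"
    "tensor_lift sU F 0 = 0"
  using linearD_field[OF linear_tensor_lift[OF assms, of F]] by auto

lemma tensor_lift_add:
  assumes "vector_space sU"
  shows "tensor_lift sU (\<lambda>u v. F u v + G u v) t = tensor_lift sU F t + tensor_lift sU G t"
proof -
  interpret vector_space sU by fact
  show ?thesis by (simp add: tensor_lift_def scale_right_distrib sum.distrib)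
qed

lemma tensor_lift_scale:
  assumes "vector_space sU"
  shows "tensor_lift sU (\<lambda>u v. sU c (F u v)) t = sU c (tensor_lift sU F t)"
proof -
  interpret vector_space sU by fact
  show ?thesis by (simp add: tensor_lift_def scale_sum_right mult.commute)
qed

lemma tensor_lift_zero:
  assumes "vector_space sU"
  shows "tensor_lift sU (\<lambda>u v. 0) t = 0"
proof -
  interpret vector_space sU by fact
  show ?thesis by (simp add: tensor_lift_def)
qed

text \<open>The outer lift is linear, so it moves inside the sum and meets a pure tensor. The
  right-hand sides of \<open>Delta_mu\<close>, \<open>rho_actl\<close>, \<open>phi_actr\<close>,
  \<open>phi_actl\<close> and \<open>rho_actr\<close> contain such inner lifts, so each of these
  becomes a plain Sweedler sum.\<close>

lemma tensor_lift_tensor_lift_tensor: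
  assumes "bilinear_map sV sW sU F"
  shows "tensor_lift sU F (tensor_lift free_scale (\<lambda>x y. tensor sV sW (f x y) (g x y)) t)
    = tensor_lift sU (\<lambda>x y. F (f x y) (g x y)) t"
proof -
  have "vector_space sU" using assms by (simp add: bilinear_map_iff)
  then show ?thesis
    by (simp add: linear_apply_tensor_lift[OF linear_tensor_lift] tensor_lift_tensor[OF assms])
qed

lemma tensor_lift_tensor_map:
  assumes "bilinear_map sV sW sU F"
  shows "tensor_lift sU F (tensor_map sV sW f g t) = tensor_lift sU (\<lambda>x y. F (f x) (g y)) t"
  unfolding tensor_map_def by (rule tensor_lift_tensor_lift_tensor[OF assms])

text \<open>Turns a coassociativity equation between iterated tensor products into an equality of
  double Sweedler sums: both sides are evaluated under the linear map on U \<otimes> (V \<otimes> W)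
  induced by \<open>G\<close>, whose trilinearity is what \<open>G12\<close> and \<open>G23\<close>
  say together.\<close>

lemma tensor_lift_coassoc:
  assumes eq: "tensor_assoc sU sV sW (tensor_map free_scale sW f g s)
      = tensor_map sU free_scale f' g' t"
    and G12: "\<And>w. bilinear_map sU sV sX (\<lambda>u v. G u v w)"
    and G23: "\<And>u. bilinear_map sV sW sX (G u)"
  shows "tensor_lift sX (\<lambda>x y. tensor_lift sX (\<lambda>u v. G u v (g y)) (f x)) s
    = tensor_lift sX (\<lambda>x y. tensor_lift sX (\<lambda>v w. G (f' x) v w) (g' y)) t"
proof -
  have X: "vector_space sX" and UW: "vector_space sU" "vector_space sW"
    using G12 G23 by (auto simp: bilinear_map_iff)
  note simps = bilinear_map_iff X UW vector_space_free_scale tensor_lift_linear[OF X]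
    tensor_lift_add[OF X] tensor_lift_scale[OF X]
  \<comment> \<open>Lifting the last two slots of \<open>G\<close> gives a bilinear map on
    \<open>U\<close> and the free space that contains V \<otimes> W; fact \<open>2\<close> does the
    same with the first two slots. These are the two ways to bracket \<open>G\<close>, and
    \<open>tensor_assoc\<close> exchanges them.\<close>
  have 1: "bilinear_map sU free_scale sX (\<lambda>u. tensor_lift sX (G u))"
  proof -
    have "G (u + u') = (\<lambda>v w. G u v w + G u' v w)" "G (sU c u) = (\<lambda>v w. sX c (G u v w))" for c u u'
      using G12 by (simp_all add: bilinear_map_iff fun_eq_iff)
    then show ?thesis by (simp add: simps)
  qed
  have 2: "bilinear_map free_scale sW sX (\<lambda>r w. tensor_lift sX (\<lambda>u v. G u v w) r)"
    using G23 by (simp add: simps)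
  have "tensor_lift sX (\<lambda>u. tensor_lift sX (G u)) (tensor_assoc sU sV sW r)
      = tensor_lift sX (\<lambda>r w. tensor_lift sX (\<lambda>u v. G u v w) r) r" for r
    unfolding tensor_assoc_def
    by (simp add: linear_apply_tensor_lift[OF linear_tensor_lift[OF X]] tensor_lift_tensor[OF 1]
        tensor_lift_tensor[OF G23])
  with arg_cong[OF eq, of "tensor_lift sX (\<lambda>u. tensor_lift sX (G u))"] show ?thesis
    by (simp add: tensor_lift_tensor_map[OF 1] tensor_lift_tensor_map[OF 2])
qed

section \<open>The BiHom-pre-Lie product of a bialgebra modulo an ideal\<close>

text \<open>
  \<open>cosum x F\<close> is the Sweedler sum of \<open>F x\<^sub>1 x\<^sub>2\<close>, which avoids the tensor square of \<open>E\<close>.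
  Compatibility modulo \<open>N \<otimes> N\<close> then means compatibility for those \<open>F\<close> that vanish on \<open>N \<times> N\<close>.
\<close>

locale infBH_bialgebra_modulo = vector_space sE
  for sE :: "'k::field \<Rightarrow> 'e::ab_group_add \<Rightarrow> 'e" +
  fixes lam :: 'k
    and mu :: "'e \<Rightarrow> 'e \<Rightarrow> 'e"
    and cosum :: "'e \<Rightarrow> ('e \<Rightarrow> 'e \<Rightarrow> 'e) \<Rightarrow> 'e"
    and al be ps om :: "'e \<Rightarrow> 'e"
    and N :: "'e set"
  assumes bilinear_mu: "bilinear_map sE sE sE mu"
    and linear_al: "Vector_Spaces.linear sE sE al"
    and linear_be: "Vector_Spaces.linear sE sE be"
    and linear_ps: "Vector_Spaces.linear sE sE ps"
    and linear_om: "Vector_Spaces.linear sE sE om"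
    and commute: "be (al x) = al (be x)" "ps (al x) = al (ps x)" "om (al x) = al (om x)"
      "ps (be x) = be (ps x)" "om (be x) = be (om x)" "om (ps x) = ps (om x)"
    and multiplicative: "al (mu x y) = mu (al x) (al y)" "be (mu x y) = mu (be x) (be y)"
      "ps (mu x y) = mu (ps x) (ps y)" "om (mu x y) = mu (om x) (om y)"
    and mu_assoc: "mu (al x) (mu y z) = mu (mu x y) (be z)"
    and linear_cosum: "Vector_Spaces.linear sE sE (\<lambda>x. cosum x F)"
    and cosum_add: "cosum x (\<lambda>u v. F u v + G u v) = cosum x F + cosum x G"
    and linear_apply_cosum:
      "Vector_Spaces.linear sE sE h \<Longrightarrow> h (cosum x F) = cosum x (\<lambda>u v. h (F u v))"
    and cosum_comultiplicative:
      "bilinear_map sE sE sE F \<Longrightarrow> cosum (al x) F = cosum x (\<lambda>u v. F (al u) (al v))"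
      "bilinear_map sE sE sE F \<Longrightarrow> cosum (be x) F = cosum x (\<lambda>u v. F (be u) (be v))"
      "bilinear_map sE sE sE F \<Longrightarrow> cosum (ps x) F = cosum x (\<lambda>u v. F (ps u) (ps v))"
      "bilinear_map sE sE sE F \<Longrightarrow> cosum (om x) F = cosum x (\<lambda>u v. F (om u) (om v))"
    and cosum_coassoc:
      "\<lbrakk>\<And>w. bilinear_map sE sE sE (\<lambda>u v. H u v w); \<And>u. bilinear_map sE sE sE (H u)\<rbrakk>
        \<Longrightarrow> cosum x (\<lambda>u v. cosum u (\<lambda>p q. H p q (ps v)))
          = cosum x (\<lambda>u v. cosum v (\<lambda>p q. H (om u) p q))"
    and ideal: "u \<in> N \<Longrightarrow> mu u x \<in> N" "u \<in> N \<Longrightarrow> mu x u \<in> N"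
    and square_zero: "\<lbrakk>u \<in> N; v \<in> N\<rbrakk> \<Longrightarrow> mu u v = 0"
    and maps_ideal: "u \<in> N \<Longrightarrow> al u \<in> N" "u \<in> N \<Longrightarrow> be u \<in> N" "u \<in> N \<Longrightarrow> ps u \<in> N"
      "u \<in> N \<Longrightarrow> om u \<in> N"
    and cosum_mu:
      "\<lbrakk>bilinear_map sE sE sE F; \<And>u v. \<lbrakk>u \<in> N; v \<in> N\<rbrakk> \<Longrightarrow> F u v = 0\<rbrakk>
        \<Longrightarrow> cosum (mu x y) F
          = cosum y (\<lambda>u v. F (mu (om x) u) (be v)) + cosum x (\<lambda>u v. F (al u) (mu v (ps y)))
            + sE lam (F (al (om x)) (be (ps y)))"
begin

definition star :: "'e \<Rightarrow> 'e \<Rightarrow> 'e" where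
  "star x y = cosum y (\<lambda>u v. mu (mu (be (be (ps u))) (al x)) (al (al (be (om v)))))"

lemma mu_linear:
  "mu (x + y) z = mu x z + mu y z" "mu (sE c x) z = sE c (mu x z)"
  "mu z (x + y) = mu z x + mu z y" "mu z (sE c x) = sE c (mu z x)"
  using bilinear_mu by (auto simp: bilinear_map_iff)

lemma mu_zero: "mu 0 x = 0" "mu x 0 = 0"
  using mu_linear(2)[of 0 0 x] mu_linear(4)[of x 0 0] by simp_all

lemma maps_linear:
  "al (x + y) = al x + al y" "al (sE c x) = sE c (al x)"
  "be (x + y) = be x + be y" "be (sE c x) = sE c (be x)"
  "ps (x + y) = ps x + ps y" "ps (sE c x) = sE c (ps x)"
  "om (x + y) = om x + om y" "om (sE c x) = sE c (om x)"
  using linear_al linear_be linear_ps linear_om by (simp_all add: Vector_Spaces.linear_iff)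

lemma cosum_linear:
  "cosum (x + y) F = cosum x F + cosum y F" "cosum (sE c x) F = sE c (cosum x F)"
  using linear_cosum[of F] by (simp_all add: Vector_Spaces.linear_iff)

lemma cosum_scale: "cosum x (\<lambda>u v. sE c (F u v)) = sE c (cosum x F)"
  using linear_apply_cosum[of "sE c" x F]
  by (simp add: Vector_Spaces.linear_iff vector_space_axioms scale_right_distrib)

text \<open>Each context is linear in the place where the sum stands. The last equation lets a
  Sweedler sum be comultiplied again, as needed to expand \<open>star x (star y z)\<close>.\<close>

lemma apply_cosum:
  "mu a (cosum x F) = cosum x (\<lambda>u v. mu a (F u v))"
  "mu (cosum x F) a = cosum x (\<lambda>u v. mu (F u v) a)"
  "al (cosum x F) = cosum x (\<lambda>u v. al (F u v))"
  "be (cosum x F) = cosum x (\<lambda>u v. be (F u v))"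
  "ps (cosum x F) = cosum x (\<lambda>u v. ps (F u v))"
  "om (cosum x F) = cosum x (\<lambda>u v. om (F u v))"
  "cosum (cosum x F) G = cosum x (\<lambda>u v. cosum (F u v) G)"
  by (rule linear_apply_cosum;
      simp add: Vector_Spaces.linear_iff vector_space_axioms mu_linear maps_linear cosum_linear
        scale_left_commute)+

lemmas linear_simps = vector_space_axioms mu_linear maps_linear cosum_linear cosum_add cosum_scale
  scale_left_commute

text \<open>\<open>mu_assoc\<close> needs a left factor of the form \<open>al x\<close>. Once
  \<open>multiplicative\<close> has pushed \<open>al\<close> into a product of two or three factors
  that form is lost; these instances restore the rewriting to left-nested products.\<close>

lemma mu_assoc_twisted:
  "mu (mu (al a) (al b)) (mu c d) = mu (mu (mu a b) c) (be d)"
  "mu (mu (mu (al a) (al b)) (al c)) (mu d e) = mu (mu (mu (mu a b) c) d) (be e)"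
  by (simp_all only: mu_assoc flip: multiplicative)

lemma bilinear_star: "bilinear_map sE sE sE star"
  by (simp add: bilinear_map_iff star_def linear_simps)

text \<open>A structure map passes into the sum by linearity and multiplicativity, and can then be
  absorbed into the comultiplied argument because it is comultiplicative and commutes with the other
  maps.\<close>

lemma map_star:
  "al (star x y) = star (al x) (al y)" "be (star x y) = star (be x) (be y)"
  "ps (star x y) = star (ps x) (ps y)" "om (star x y) = star (om x) (om y)"
  by (simp_all add: star_def apply_cosum cosum_comultiplicative bilinear_map_iff linear_simps
      multiplicative commute)

lemma star_preLie:
  defines "al' \<equiv> al \<circ> al \<circ> be" and "be' \<equiv> al \<circ> al \<circ> be \<circ> be \<circ> ps \<circ> om"
  shows "star (al' (be' x)) (star (al' y) z) - star (star (be' x) (al' y)) (be' z)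
    = star (al' (be' y)) (star (al' x) z) - star (star (be' y) (al' x)) (be' z)"
proof -
  \<comment> \<open>\<open>W x y p q r\<close> is the left-nested product \<open>p y q x r\<close>,
    and the summand of \<open>L x y\<close> is \<open>u y x v\<close>. The exponents of the
    structure maps are those of the normal form of the expanded iterated product.\<close>
  define W where "W = (\<lambda>x y p q r. mu (mu (mu (mu ((be^^4) (ps (ps p)))
      ((al^^3) ((be^^3) (ps (om y))))) ((al^^2) ((be^^3) (ps (om q)))))
      ((al^^5) ((be^^3) (ps (om x))))) ((al^^4) ((be^^3) (om (om r)))))"
  define L where "L x y = cosum z (\<lambda>u v. mu (mu (mu (al ((be^^4) (ps (ps (om u)))))
      ((al^^4) ((be^^3) (ps (om y))))) ((al^^5) ((be^^3) (ps (om x)))))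
      ((al^^4) ((be^^3) (ps (om (om v))))))" for x y
  define S where "S x y = cosum z (\<lambda>u v. cosum v (\<lambda>p q. W x y (om u) p q))" for x y
  have S: "cosum z (\<lambda>u v. cosum u (\<lambda>p q. W x y p q (ps v))) = S x y" for x y
    unfolding S_def
    by (rule cosum_coassoc)
      (simp_all add: W_def numeral_eq_Suc bilinear_map_iff linear_simps)
  \<comment> \<open>The coproduct of \<open>z1 y z2\<close> has five terms. The one that splits
    \<open>y\<close> gives \<open>z1 y1 x y2 z2\<close>, which is the product
    \<open>(x star y) star z\<close>; splitting \<open>z2\<close> gives \<open>S x y\<close>,
    splitting \<open>z1\<close> gives \<open>S y x\<close>, and the two weight terms give
    \<open>L x y\<close> and \<open>L y x\<close>.\<close>
  have "star (al' (be' x)) (star (al' y) z)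
      = star (star (be' x) (al' y)) (be' z) + (S x y + S y x + sE lam (L x y + L y x))" for x y
    \<comment> \<open>\<open>S y x\<close> arises with the first leg of \<open>z\<close> split and
      \<open>S x y\<close> with the second, so coassociativity is applied to only one of
      them.\<close>
    unfolding S[of y x, symmetric] unfolding S_def
    \<comment> \<open>\<open>cosum_mu\<close> is applicable because inserting an element between
      \<open>u\<close> and \<open>v\<close> in \<open>N\<close> yields a product of two elements of
      \<open>N\<close>, which is zero.\<close>
    by (simp add: star_def al'_def be'_def W_def L_def numeral_eq_Suc apply_cosum
        cosum_comultiplicative cosum_mu ideal maps_ideal square_zero mu_zero bilinear_map_iff linear_simps
        multiplicative commute mu_assoc mu_assoc_twisted scale_right_distrib)
  then show ?thesis
    by (simp add: add.commute)
qed

lemma bihom_preLie_algebra_star: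
  "bihom_preLie_algebra sE star (al \<circ> al \<circ> be) (al \<circ> al \<circ> be \<circ> be \<circ> ps \<circ> om)"
  by unfold_locales
    (simp_all only: bilinear_star star_preLie,
     simp_all add: Vector_Spaces.linear_iff linear_simps commute map_star)

end

section \<open>The square-zero extension by a Hopf bimodule\<close>

text \<open>The added conditions make the diagonal structure maps of the extension multiplicative
  and comultiplicative. The Hopf bimodule in \<open>Hopf_bimodule_not_preLie_bimodule\<close>
  violates \<open>alM_rho\<close>, and there the conclusion fails.\<close>

locale compatible_Hopf_bimodule =
  infBH_Hopf_bimodule sA lam mu Delta alA beA psA omA sM actl actr rho phi alM beM psM omM
  for sA :: "'k::field \<Rightarrow> 'a::ab_group_add \<Rightarrow> 'a"
    and lam :: 'k
    and mu :: "'a \<Rightarrow> 'a \<Rightarrow> 'a"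
    and Delta :: "'a \<Rightarrow> ('a \<times> 'a \<Rightarrow>\<^sub>0 'k)"
    and alA beA psA omA :: "'a \<Rightarrow> 'a"
    and sM :: "'k \<Rightarrow> 'm::ab_group_add \<Rightarrow> 'm"
    and actl :: "'a \<Rightarrow> 'm \<Rightarrow> 'm"
    and actr :: "'m \<Rightarrow> 'a \<Rightarrow> 'm"
    and rho :: "'m \<Rightarrow> ('a \<times> 'm \<Rightarrow>\<^sub>0 'k)"
    and phi :: "'m \<Rightarrow> ('m \<times> 'a \<Rightarrow>\<^sub>0 'k)"
    and alM beM psM omM :: "'m \<Rightarrow> 'm" +
  assumes alM_rho: "tensor_map sA sM alA alM (rho m) = rho (alM m)"
    and beM_rho: "tensor_map sA sM beA beM (rho m) = rho (beM m)"
    and alM_phi: "tensor_map sM sA alM alA (phi m) = phi (alM m)"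
    and beM_phi: "tensor_map sM sA beM beA (phi m) = phi (beM m)"
    and psM_actl: "psM (actl a m) = actl (psA a) (psM m)"
    and omM_actl: "omM (actl a m) = actl (omA a) (omM m)"
    and psM_actr: "psM (actr m a) = actr (psM m) (psA a)"
    and omM_actr: "omM (actr m a) = actr (omM m) (omA a)"
begin

definition scale_ext :: "'k \<Rightarrow> 'a \<times> 'm \<Rightarrow> 'a \<times> 'm" where
  "scale_ext c = map_prod (sA c) (sM c)"

definition mu_ext :: "'a \<times> 'm \<Rightarrow> 'a \<times> 'm \<Rightarrow> 'a \<times> 'm" where
  "mu_ext x y = (mu (fst x) (fst y), actl (fst x) (snd y) + actr (snd x) (fst y))"

text \<open>The summands are the components in A \<otimes> A, A \<otimes> M and M \<otimes> A; the
  component in M \<otimes> M is zero.\<close>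

definition cosum_ext :: "'a \<times> 'm \<Rightarrow> ('a \<times> 'm \<Rightarrow> 'a \<times> 'm \<Rightarrow> 'a \<times> 'm) \<Rightarrow> 'a \<times> 'm" where
  "cosum_ext x F = tensor_lift scale_ext (\<lambda>u v. F (u, 0) (v, 0)) (Delta (fst x))
    + tensor_lift scale_ext (\<lambda>u n. F (u, 0) (0, n)) (rho (snd x))
    + tensor_lift scale_ext (\<lambda>n u. F (0, n) (u, 0)) (phi (snd x))"

lemma vector_spaces:
  shows vector_space_A: "vector_space sA" and vector_space_M: "vector_space sM"
  using linear_alA linear_alM by (auto dest: linearD_field)

lemma vector_space_ext: "vector_space scale_ext"
proof -
  interpret A: vector_space sA by (rule vector_space_A)
  interpret M: vector_space sM by (rule vector_space_M)
  show ?thesis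
    by unfold_locales
      (auto simp: scale_ext_def A.scale_right_distrib A.scale_left_distrib
        M.scale_right_distrib M.scale_left_distrib)
qed

lemma scale_ext_simps:
  "scale_ext c (a, m) = (sA c a, sM c m)"
  "fst (scale_ext c x) = sA c (fst x)" "snd (scale_ext c x) = sM c (snd x)"
  by (simp_all add: scale_ext_def)

lemma scale_zero: "sA c 0 = 0" "sM c 0 = 0"
proof -
  interpret A: vector_space sA by (rule vector_space_A)
  interpret M: vector_space sM by (rule vector_space_M)
  show "sA c 0 = 0" "sM c 0 = 0" by simp_all
qed

lemmas structure_maps_linear =
  linearD_field(3,4,6)[OF linear_alA] linearD_field(3,4,6)[OF linear_beA]
  linearD_field(3,4,6)[OF linear_psA] linearD_field(3,4,6)[OF linear_omA]
  linearD_field(3,4,6)[OF linear_alM] linearD_field(3,4,6)[OF linear_beM]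
  linearD_field(3,4,6)[OF linear_psM] linearD_field(3,4,6)[OF linear_omM]

lemma comultiplications_linear:
  "Delta (a + b) = Delta a + Delta b" "Delta (sA c a) = free_scale c (Delta a)" "Delta 0 = 0"
  "rho (m + n) = rho m + rho n" "rho (sM c m) = free_scale c (rho m)" "rho 0 = 0"
  "phi (m + n) = phi m + phi n" "phi (sM c m) = free_scale c (phi m)" "phi 0 = 0"
  using linear_Delta linear_rho linear_phi
  by (auto simp: linear_to_tensor_def dest: linearD_field)

lemma products_linear:
  "mu (a + b) d = mu a d + mu b d" "mu (sA c a) d = sA c (mu a d)" "mu 0 d = 0"
  "mu d (a + b) = mu d a + mu d b" "mu d (sA c a) = sA c (mu d a)" "mu d 0 = 0"
  "actl (a + b) m = actl a m + actl b m" "actl (sA c a) m = sM c (actl a m)" "actl 0 m = 0"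
  "actl a (m + n) = actl a m + actl a n" "actl a (sM c m) = sM c (actl a m)" "actl a 0 = 0"
  "actr (m + n) a = actr m a + actr n a" "actr (sM c m) a = sM c (actr m a)" "actr 0 a = 0"
  "actr m (a + b) = actr m a + actr m b" "actr m (sA c a) = sM c (actr m a)" "actr m 0 = 0"
  using bilinear_mu bilinear_actl bilinear_actr
    bilinear_map_zero[OF bilinear_mu] bilinear_map_zero[OF bilinear_actl]
    bilinear_map_zero[OF bilinear_actr]
  by (auto simp: bilinear_map_iff)

lemma scale_add:
  "sA c (a + b) = sA c a + sA c b" "sM c (m + n) = sM c m + sM c n"
  using vector_space_A vector_space_M by (auto simp: vector_space_def)

lemma bilinear_restrict:
  assumes "bilinear_map scale_ext scale_ext scale_ext F"
  shows "bilinear_map sA sA scale_ext (\<lambda>u v. F (u, 0) (v, 0))"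
    "bilinear_map sA sM scale_ext (\<lambda>u n. F (u, 0) (0, n))"
    "bilinear_map sM sA scale_ext (\<lambda>n u. F (0, n) (u, 0))"
proof -
  have split: "(a + b, 0 :: 'm) = (a, 0) + (b, 0)" "(0 :: 'a, m + n) = (0, m) + (0, n)"
    "(sA c a, 0) = scale_ext c (a, 0)" "(0, sM c m) = scale_ext c (0, m)"
    for a b :: 'a and m n :: 'm and c
    by (simp_all add: scale_ext_simps scale_zero)
  show "bilinear_map sA sA scale_ext (\<lambda>u v. F (u, 0) (v, 0))"
    "bilinear_map sA sM scale_ext (\<lambda>u n. F (u, 0) (0, n))"
    "bilinear_map sM sA scale_ext (\<lambda>n u. F (0, n) (u, 0))"
    using assms by (simp_all only: split bilinear_map_iff vector_space_A vector_space_M) simp_all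
qed

lemma bilinear_decompose:
  assumes "bilinear_map scale_ext scale_ext scale_ext F"
    and "\<And>m n. F (0, m) (0, n) = 0"
  shows "F (a, m) (b, n) = F (a, 0) (b, 0) + F (a, 0) (0, n) + F (0, m) (b, 0)"
proof -
  have "F ((a, 0) + (0, m)) ((b, 0) + (0, n))
      = F (a, 0) (b, 0) + F (a, 0) (0, n) + F (0, m) (b, 0)"
    using assms by (simp only: bilinear_map_iff) (simp add: assms(2))
  then show ?thesis by simp
qed

text \<open>The component in A \<otimes> A is \<open>Delta_mu\<close>; those in A \<otimes> M and M
  \<otimes> A combine \<open>rho_actl\<close> with \<open>rho_actr\<close> and
  \<open>phi_actl\<close> with \<open>phi_actr\<close>. In M \<otimes> M the left side has nothing,
  while the right side has terms such as the weight term in the two module parts; \<open>F0\<close>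
  removes these.\<close>

lemma cosum_ext_mu_ext:
  assumes F: "bilinear_map scale_ext scale_ext scale_ext F"
    and F0: "\<And>m n. F (0, m) (0, n) = 0"
  shows "cosum_ext (mu_ext x y) F
    = cosum_ext y (\<lambda>u v. F (mu_ext (map_prod omA omM x) u) (map_prod beA beM v))
      + cosum_ext x (\<lambda>u v. F (map_prod alA alM u) (mu_ext v (map_prod psA psM y)))
      + scale_ext lam (F (map_prod alA alM (map_prod omA omM x))
          (map_prod beA beM (map_prod psA psM y)))"
proof -
  interpret vector_space scale_ext by (rule vector_space_ext)
  define F1 F2 F3 where "F1 = (\<lambda>u v. F (u, 0) (v, 0))"
    and "F2 = (\<lambda>u n. F (u, 0) (0, n))" and "F3 = (\<lambda>n u. F (0, n) (u, 0))"
  have bil: "bilinear_map sA sA scale_ext F1" "bilinear_map sA sM scale_ext F2"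
    "bilinear_map sM sA scale_ext F3"
    using bilinear_restrict[OF F] by (simp_all add: F1_def F2_def F3_def)
  have F_eq: "F p q = F1 (fst p) (fst q) + F2 (fst p) (snd q) + F3 (snd p) (fst q)" for p q
    using bilinear_decompose[OF F F0, of "fst p" "snd p" "fst q" "snd q"]
    by (simp add: F1_def F2_def F3_def)
  note zero = bilinear_map_zero[OF bil(1)] bilinear_map_zero[OF bil(2)] bilinear_map_zero[OF bil(3)]
  obtain a m b n where xy: "x = (a, m)" "y = (b, n)" by fastforce
  have add: "F3 (p + q) u = F3 p u + F3 q u" "F2 u (p + q) = F2 u p + F2 u q" for p q u
    using bil by (simp_all add: bilinear_map_iff)
  show ?thesis
    by (simp add: xy cosum_ext_def mu_ext_def F_eq zero products_linear structure_maps_linear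
        comultiplications_linear tensor_lift_linear[OF vector_space_ext]
        tensor_lift_add[OF vector_space_ext] scale_right_distrib add
        Delta_mu rho_actl rho_actr phi_actl phi_actr
        tensor_lift_tensor_lift_tensor[OF bil(1)] tensor_lift_tensor_lift_tensor[OF bil(2)]
        tensor_lift_tensor_lift_tensor[OF bil(3)] tensor_lift_tensor[OF bil(1)]
        tensor_lift_tensor[OF bil(2)] tensor_lift_tensor[OF bil(3)])
qed

text \<open>Only tensors with at most one factor in \<open>M\<close> occur. The components AAA, AAM,
  AMA and MAA are \<open>Delta_coassoc\<close>, \<open>rho_rho\<close>, \<open>rho_phi\<close> and
  \<open>phi_phi\<close>.\<close>

lemma cosum_ext_coassoc:
  assumes "\<And>w. bilinear_map scale_ext scale_ext scale_ext (\<lambda>u v. G u v w)"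
    and "\<And>u. bilinear_map scale_ext scale_ext scale_ext (G u)"
  shows "cosum_ext x (\<lambda>u v. cosum_ext u (\<lambda>p q. G p q (map_prod psA psM v)))
    = cosum_ext x (\<lambda>u v. cosum_ext v (\<lambda>p q. G (map_prod omA omM u) p q))"
proof -
  note G12 = bilinear_restrict[OF assms(1)] and G23 = bilinear_restrict[OF assms(2)]
  note coassoc = tensor_lift_coassoc[OF Delta_coassoc G12(1) G23(1)]
    tensor_lift_coassoc[OF rho_rho[symmetric] G12(1) G23(2)]
    tensor_lift_coassoc[OF rho_phi[symmetric] G12(2) G23(3)]
    tensor_lift_coassoc[OF phi_phi[symmetric] G12(3) G23(1)]
  show ?thesis
    by (simp add: cosum_ext_def structure_maps_linear comultiplications_linear
        tensor_lift_linear[OF vector_space_ext] tensor_lift_add[OF vector_space_ext]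
        coassoc add.assoc)
qed

lemma cosum_ext_comultiplicative:
  assumes "bilinear_map scale_ext scale_ext scale_ext F"
  shows "cosum_ext (map_prod alA alM x) F
      = cosum_ext x (\<lambda>u v. F (map_prod alA alM u) (map_prod alA alM v))"
    "cosum_ext (map_prod beA beM x) F
      = cosum_ext x (\<lambda>u v. F (map_prod beA beM u) (map_prod beA beM v))"
    "cosum_ext (map_prod psA psM x) F
      = cosum_ext x (\<lambda>u v. F (map_prod psA psM u) (map_prod psA psM v))"
    "cosum_ext (map_prod omA omM x) F
      = cosum_ext x (\<lambda>u v. F (map_prod omA omM u) (map_prod omA omM v))"
  using bilinear_restrict[OF assms]
  by (simp_all add: cosum_ext_def structure_maps_linear tensor_lift_tensor_map
      flip: alA_Delta beA_Delta psA_Delta omA_Delta alM_rho beM_rho psM_rho omM_rho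
        alM_phi beM_phi psM_phi omM_phi)

lemma infBH_bialgebra_modulo_ext:
  "infBH_bialgebra_modulo scale_ext lam mu_ext cosum_ext (map_prod alA alM) (map_prod beA beM)
    (map_prod psA psM) (map_prod omA omM) ({0} \<times> UNIV)"
proof -
  interpret vector_space scale_ext by (rule vector_space_ext)
  have linear_prod: "Vector_Spaces.linear scale_ext scale_ext (map_prod f g)"
    if "Vector_Spaces.linear sA sA f" "Vector_Spaces.linear sM sM g" for f g
    using that linearD_field(3,4)[OF that(1)] linearD_field(3,4)[OF that(2)]
    by (intro linearI_field vector_space_ext) (auto simp: scale_ext_def)
  show ?thesis
  proof (intro infBH_bialgebra_modulo.intro infBH_bialgebra_modulo_axioms.intro vector_space_ext)
    show "bilinear_map scale_ext scale_ext scale_ext mu_ext"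
      by (simp add: bilinear_map_iff vector_space_ext mu_ext_def scale_ext_def products_linear
          scale_add)
    show "Vector_Spaces.linear scale_ext scale_ext (\<lambda>x. cosum_ext x F)" for F
      by (intro linearI_field vector_space_ext)
        (simp_all add: cosum_ext_def scale_ext_simps comultiplications_linear
          tensor_lift_linear[OF vector_space_ext] scale_right_distrib)
    show "cosum_ext x (\<lambda>u v. F u v + G u v) = cosum_ext x F + cosum_ext x G" for x F G
      by (simp add: cosum_ext_def tensor_lift_add[OF vector_space_ext])
    show "h (cosum_ext x F) = cosum_ext x (\<lambda>u v. h (F u v))"
      if "Vector_Spaces.linear scale_ext scale_ext h" for h x F
      by (simp add: cosum_ext_def linearD_field(3)[OF that] linear_apply_tensor_lift[OF that])
  \<comment> \<open>The remaining conditions are checked componentwise. In particular, associativity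
    in the module component splits into \<open>actl_actl\<close>, \<open>actl_actr\<close> and
    \<open>actr_actr\<close>, according to which factor lies in \<open>M\<close>.\<close>
  qed (auto simp: linear_prod linear_alA linear_beA linear_psA linear_omA linear_alM linear_beM
      linear_psM linear_omM alA_beA alA_psA alA_omA beA_psA beA_omA psA_omA
      alM_beM alM_psM alM_omM beM_psM beM_omM psM_omM mu_ext_def alA_mu beA_mu psA_mu omA_mu
      alM_actl alM_actr beM_actl beM_actr psM_actl psM_actr omM_actl omM_actr
      structure_maps_linear mu_assoc actl_actl actr_actr actl_actr products_linear
      cosum_ext_comultiplicative cosum_ext_coassoc cosum_ext_mu_ext[unfolded mu_ext_def]
      zero_prod_def)
qed

section \<open>Components of the product on the extension\<close>

interpretation ext: infBH_bialgebra_modulo scale_ext lam mu_ext cosum_ext "map_prod alA alM"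
  "map_prod beA beM" "map_prod psA psM" "map_prod omA omM" "{0} \<times> UNIV"
  by (rule infBH_bialgebra_modulo_ext)

abbreviation (input) "opA \<equiv> star_A sA mu Delta alA beA psA omA"
abbreviation (input) "opl \<equiv> star_left mu alA beA psA omA sM actl actr rho phi alM beM psM omM"
abbreviation (input) "opr \<equiv> star_right Delta alA beA psA omA sM actl actr alM"

lemma tensor_lift_Pair:
  "tensor_lift scale_ext (\<lambda>u v. (f u v, g u v)) t = (tensor_lift sA f t, tensor_lift sM g t)"
proof -
  have "Vector_Spaces.linear scale_ext sA fst" "Vector_Spaces.linear scale_ext sM snd"
    by (intro linearI_field vector_space_ext vector_space_A vector_space_M;
        simp add: scale_ext_simps)+
  then show ?thesis
    by (simp add: prod_eq_iff linear_apply_tensor_lift)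
qed

text \<open>Products with two factors in \<open>M\<close> vanish. Hence the coactions of
  \<open>n\<close> only enclose \<open>a\<close>, which gives both sums of \<open>opl\<close>,
  whereas \<open>Delta b\<close> encloses \<open>a\<close> and \<open>m\<close>, which gives
  \<open>opA\<close> and \<open>opr\<close>.\<close>

lemma star_ext: "ext.star (a, m) (b, n) = (opA a b, opl a n + opr m b)"
  by (simp add: ext.star_def cosum_ext_def mu_ext_def products_linear structure_maps_linear
      tensor_lift_Pair star_A_def star_left_def star_right_def
      tensor_lift_zero[OF vector_space_A] tensor_lift_zero[OF vector_space_M])

lemma star_zero:
  "opA 0 b = 0" "opA a 0 = 0" "opl 0 n = 0" "opl a 0 = 0" "opr 0 b = 0" "opr m 0 = 0"
  by (simp_all add: star_A_def star_left_def star_right_def products_linear structure_maps_linear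
      comultiplications_linear tensor_lift_zero[OF vector_space_A]
      tensor_lift_zero[OF vector_space_M] tensor_lift_linear(3)[OF vector_space_A]
      tensor_lift_linear(3)[OF vector_space_M])

lemma bihom_preLie_bimodule_star:
  "bihom_preLie_bimodule sA opA (alA \<circ> alA \<circ> beA) (alA \<circ> alA \<circ> beA \<circ> beA \<circ> psA \<circ> omA)
    sM opl opr (alM \<circ> alM \<circ> beM) (alM \<circ> alM \<circ> beM \<circ> beM \<circ> psM \<circ> omM)"
proof -
  \<comment> \<open>Names for the composites keep them opaque, so that the maps of the extension are
    \<open>map_prod\<close> of two single maps.\<close>
  define alA' beA' alM' beM' where defs: "alA' = alA \<circ> alA \<circ> beA"
    "beA' = alA \<circ> alA \<circ> beA \<circ> beA \<circ> psA \<circ> omA" "alM' = alM \<circ> alM \<circ> beM"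
    "beM' = alM \<circ> alM \<circ> beM \<circ> beM \<circ> psM \<circ> omM"
  have "bihom_preLie_algebra scale_ext ext.star (map_prod alA' alM') (map_prod beA' beM')"
    using ext.bihom_preLie_algebra_star by (simp add: defs map_prod_compose)
  then interpret E: bihom_preLie_algebra scale_ext ext.star "map_prod alA' alM'"
    "map_prod beA' beM'" .
  have lin: "Vector_Spaces.linear sA sA alA'" "Vector_Spaces.linear sA sA beA'"
    "Vector_Spaces.linear sM sM alM'" "Vector_Spaces.linear sM sM beM'"
    unfolding defs
    by (rule linearI_field; simp add: vector_spaces structure_maps_linear)+
  note zero = lin[THEN linearD_field(6)] star_zero
  have bil: "ext.star (x + y) z = ext.star x z + ext.star y z"
    "ext.star z (x + y) = ext.star z x + ext.star z y"
    "ext.star (scale_ext c x) z = scale_ext c (ext.star x z)"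
    "ext.star z (scale_ext c x) = scale_ext c (ext.star z x)" for x y z c
    using E.bilinear_opA by (simp_all only: bilinear_map_iff)
  note simps = star_ext zero scale_ext_simps scale_zero
  have "bihom_preLie_bimodule sA opA alA' beA' sM opl opr alM' beM'"
  proof (intro bihom_preLie_bimodule.intro bihom_preLie_algebra.intro
      bihom_preLie_bimodule_axioms.intro lin)
    \<comment> \<open>Each condition is one component of the corresponding condition on the
      extension, taken at arguments of the form \<open>(a, 0)\<close> or \<open>(0, m)\<close>;
      \<open>star_zero\<close> clears the other terms.\<close>
    fix a b c :: 'a and m :: 'm
    show "bilinear_map sA sA sA opA"
      using bil(1,2)[where x = "(a, 0)" and y = "(b, 0)" and z = "(d, 0)" for a b d]
        bil(3,4)[where x = "(a, 0)" and z = "(d, 0)" for a d]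
      by (simp add: bilinear_map_iff vector_space_A simps)
    show "bilinear_map sA sM sM opl"
      using bil(1)[where x = "(a, 0)" and y = "(b, 0)" and z = "(0, n)" for a b n]
        bil(3)[where x = "(a, 0)" and z = "(0, n)" for a n]
        bil(2)[where x = "(0, m)" and y = "(0, n)" and z = "(a, 0)" for a m n]
        bil(4)[where x = "(0, m)" and z = "(a, 0)" for a m]
      by (simp add: bilinear_map_iff vector_spaces simps)
    show "bilinear_map sM sA sM opr"
      using bil(2)[where x = "(a, 0)" and y = "(b, 0)" and z = "(0, n)" for a b n]
        bil(4)[where x = "(a, 0)" and z = "(0, n)" for a n]
        bil(1)[where x = "(0, m)" and y = "(0, n)" and z = "(a, 0)" for a m n]
        bil(3)[where x = "(0, m)" and z = "(a, 0)" for a m]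
      by (simp add: bilinear_map_iff vector_spaces simps)
    show "alA' (beA' a) = beA' (alA' a)" "alM' (beM' m) = beM' (alM' m)"
      using E.al_be[of "(a, m)"] by simp_all
    show "alA' (opA a b) = opA (alA' a) (alA' b)"
      using E.al_opA[of "(a, 0)" "(b, 0)"] by (simp add: simps)
    show "beA' (opA a b) = opA (beA' a) (beA' b)"
      using E.be_opA[of "(a, 0)" "(b, 0)"] by (simp add: simps)
    show "alM' (opl a m) = opl (alA' a) (alM' m)"
      using E.al_opA[of "(a, 0)" "(0, m)"] by (simp add: simps)
    show "beM' (opl a m) = opl (beA' a) (beM' m)"
      using E.be_opA[of "(a, 0)" "(0, m)"] by (simp add: simps)
    show "alM' (opr m a) = opr (alM' m) (alA' a)"
      using E.al_opA[of "(0, m)" "(a, 0)"] by (simp add: simps)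
    show "beM' (opr m a) = opr (beM' m) (beA' a)"
      using E.be_opA[of "(0, m)" "(a, 0)"] by (simp add: simps)
    show "opA (alA' (beA' a)) (opA (alA' b) c) - opA (opA (beA' a) (alA' b)) (beA' c)
      = opA (alA' (beA' b)) (opA (alA' a) c) - opA (opA (beA' b) (alA' a)) (beA' c)"
      using E.preLie[of "(a, 0)" "(b, 0)" "(c, 0)"] by (simp add: simps)
    show "opl (alA' (beA' a)) (opl (alA' b) m) - opl (opA (beA' a) (alA' b)) (beM' m)
      = opl (alA' (beA' b)) (opl (alA' a) m) - opl (opA (beA' b) (alA' a)) (beM' m)"
      using E.preLie[of "(a, 0)" "(b, 0)" "(0, m)"] by (simp add: simps)
    show "opl (alA' (beA' a)) (opr (alM' m) c) - opr (opl (beA' a) (alM' m)) (beA' c)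
      = opr (alM' (beM' m)) (opA (alA' a) c) - opr (opr (beM' m) (alA' a)) (beA' c)"
      using E.preLie[of "(a, 0)" "(0, m)" "(c, 0)"] by (simp add: simps)
  qed
  then show ?thesis by (simp only: defs)
qed

end

theorem proposition2p41:
  fixes sA :: "'k::field \<Rightarrow> 'a::ab_group_add \<Rightarrow> 'a"
    and lam :: 'k
    and mu :: "'a \<Rightarrow> 'a \<Rightarrow> 'a"
    and Delta :: "'a \<Rightarrow> ('a \<times> 'a \<Rightarrow>\<^sub>0 'k)"
    and alA beA psA omA :: "'a \<Rightarrow> 'a"
    and sM :: "'k \<Rightarrow> 'm::ab_group_add \<Rightarrow> 'm"
    and actl :: "'a \<Rightarrow> 'm \<Rightarrow> 'm"
    and actr :: "'m \<Rightarrow> 'a \<Rightarrow> 'm"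
    and rho :: "'m \<Rightarrow> ('a \<times> 'm \<Rightarrow>\<^sub>0 'k)"
    and phi :: "'m \<Rightarrow> ('m \<times> 'a \<Rightarrow>\<^sub>0 'k)"
    and alM beM psM omM :: "'m \<Rightarrow> 'm"
  assumes "infBH_bialgebra sA lam mu Delta alA beA psA omA"
    and "infBH_Hopf_bimodule sA lam mu Delta alA beA psA omA
      sM actl actr rho phi alM beM psM omM"
    and "\<And>m. tensor_map sA sM alA alM (rho m) = rho (alM m)"
    and "\<And>m. tensor_map sA sM beA beM (rho m) = rho (beM m)"
    and "\<And>m. tensor_map sM sA alM alA (phi m) = phi (alM m)"
    and "\<And>m. tensor_map sM sA beM beA (phi m) = phi (beM m)"
    and "\<And>a m. psM (actl a m) = actl (psA a) (psM m)"
    and "\<And>a m. omM (actl a m) = actl (omA a) (omM m)"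
    and "\<And>m a. psM (actr m a) = actr (psM m) (psA a)"
    and "\<And>m a. omM (actr m a) = actr (omM m) (omA a)"
  shows "bihom_preLie_bimodule
      sA (star_A sA mu Delta alA beA psA omA)
      (alA \<circ> alA \<circ> beA) (alA \<circ> alA \<circ> beA \<circ> beA \<circ> psA \<circ> omA)
      sM (star_left mu alA beA psA omA sM actl actr rho phi alM beM psM omM)
      (star_right Delta alA beA psA omA sM actl actr alM)
      (alM \<circ> alM \<circ> beM) (alM \<circ> alM \<circ> beM \<circ> beM \<circ> psM \<circ> omM)"
proof -
  interpret compatible_Hopf_bimodule sA lam mu Delta alA beA psA omA
    sM actl actr rho phi alM beM psM omM
    using assms by (intro compatible_Hopf_bimodule.intro compatible_Hopf_bimodule_axioms.intro)
  show ?thesis by (rule bihom_preLie_bimodule_star)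
qed

end
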